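(* Let $k$ be a fixed positive integer. (i) $$\mathbb{E}[Z_{n,k}^2]\sim\frac{n^{2k}}{(k!)^4}\qquad\text{as }n\to\infty.$$ (ii) $$\mathrm{Var}(Z_{n,k})\sim\frac{1}{2((2k-1)!)^2}\left[\binom{4k-2}{2k-1}-2\binom{2k-1}{k}^2\right]n^{2k-1}\qquad\text{as }n\to\infty.$$ Here the first two moments are $\mathbb{E}[Z_{n,k}]=\binom nk\frac1{k!}$ and $$\mathbb{E}[Z_{n,k}^2]=\sum_{\substack{t,s\ge0\\ t+s\le k}}\frac{4^{k-t}}{(2k-t)!}\binom{n}{2k-t}\binom{k-t-s-1/2}{k-t-s}\binom{s+(t+1)/2-1}{s}\binom{2k-t}{2k-2t-2s}.$$
   Context: $Z_{n,k}=\sum_{1\le i_1<\cdots<i_k\le n}\mathbf{1}(\pi(i_1)<\cdots<\pi(i_k))$ is the number of increasing subsequences of length $k$ of a uniformly random permutation $\pi$ of $\{1,\ldots,n\}$. For real $x$ and integer $m\ge0$, $\binom{x}{m}=x(x-1)\cdots(x-m+1)/m!$. $a_n\sim b_n$ means $a_n/b_n\to1$ as $n\to\infty$. *)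

theory Defs
  imports "HOL-Probability.Probability" "HOL-Library.Landau_Symbols"
begin

definition random_perm :: "nat \<Rightarrow> (nat \<Rightarrow> nat) pmf" where
  "random_perm n = pmf_of_set {\<pi>. \<pi> permutes {1..n}}"

text \<open>
  A strictly increasing list \<open>[i\<^sub>1, \<dots>, i\<^sub>k]\<close> over \<open>{1..n}\<close> encodes a choice
  \<open>1 \<le> i\<^sub>1 < \<dots> < i\<^sub>k \<le> n\<close>.
\<close>

definition index_tuples :: "nat \<Rightarrow> nat \<Rightarrow> nat list set" where
  "index_tuples n k = {is. length is = k \<and> set is \<subseteq> {1..n} \<and> sorted_wrt (<) is}"

definition Z :: "nat \<Rightarrow> nat \<Rightarrow> (nat \<Rightarrow> nat) \<Rightarrow> real" where
  "Z n k \<pi> = (\<Sum>is\<in>index_tuples n k. of_bool (sorted_wrt (<) (map \<pi> is)))"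

text \<open>
  In the statement, \<open>f \<sim>[sequentially] g\<close> says that \<open>f n / g n\<close> tends to 1, where a quotient
  \<open>0 / 0\<close> is read as 1. This convention matters only for the variance in the case \<open>k = 1\<close>, where
  \<open>Z n 1 = n\<close> almost surely and both sides are identically 0.
\<close>

end

theory Submission
  imports Defs "HOL-Computational_Algebra.Formal_Power_Series" "HOL-Library.Sublist"
    "HOL-Combinatorics.Multiset_Permutations" "HOL-Real_Asymp.Real_Asymp"
begin

text \<open>
  Both moments are obtained by counting. Squaring the sum that defines \<open>Z n k\<close> gives a sum over
  pairs \<open>(A, B)\<close> of \<open>k\<close>-element index sets, and the permutation has to increase on \<open>A\<close> and on \<open>B\<close>.
  If \<open>A\<close> and \<open>B\<close> share \<open>t\<close> indices, the shared indices cut \<open>A\<close> and \<open>B\<close> into \<open>t + 1\<close> gaps, where gap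
  number \<open>r\<close> holds \<open>a\<^sub>r\<close> indices of \<open>A\<close> only and \<open>b\<^sub>r\<close> indices of \<open>B\<close> only. The list of the pairs
  \<open>(a\<^sub>r, b\<^sub>r)\<close> is called the gap list. It decides everything twice over.
  \<^item> Positions: a union of \<open>2k - t\<close> positions can be chosen in \<open>n choose (2k - t)\<close> ways, and inside each
    gap the two kinds of indices are shuffled freely, so that the product of the \<open>(a\<^sub>r + b\<^sub>r) choose a\<^sub>r\<close>
    counts the pairs with this union (\<open>card_pairs_with_gaps\<close>).
  \<^item> Values: the relative order of the values on the union is uniform among \<open>(2k - t)!\<close> orders, and
    the orders that increase on \<open>A\<close> and on \<open>B\<close> are again given by one shuffle in each gap
    (\<open>card_linear_extensions\<close>).

  Hence the second moment is the sum over \<open>t\<close> of \<open>(n choose (2k - t)) / (2k - t)!\<close> times the sum of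
  the squared products over all gap lists of length \<open>t + 1\<close> whose entries add up to \<open>k - t\<close> in both
  components. This inner sum is the coefficient of \<open>x\<^sup>k\<^sup>-\<^sup>t y\<^sup>k\<^sup>-\<^sup>t\<close> in the power \<open>t + 1\<close> of the series
  with coefficients \<open>((a + b) choose a)\<^sup>2\<close>. That series is the inverse square root of
  \<open>(1 - x - y)\<^sup>2 - 4xy\<close>, and expanding its powers in \<open>4xy / (1 - x - y)\<^sup>2\<close> by the binomial series
  produces the stated double sum (\<open>gap_series_nth\<close>, \<open>gap_series_1_nth\<close>).

  For the asymptotics only small \<open>t\<close> matters. The term \<open>t = 0\<close> equals the falling factorial of length
  \<open>2k\<close> over \<open>(k!)\<^sup>4\<close>, which gives (i). In the variance it meets the square of the falling factorial of
  length \<open>k\<close> over \<open>(k!)\<^sup>4\<close>; the leading powers cancel and \<open>- k\<^sup>2 / (k!)\<^sup>4\<close> remains at order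
  \<open>2k - 1\<close>. The term \<open>t = 1\<close> adds a multiple of \<open>(4k - 2) choose (2k - 1)\<close>, because its inner sum is
  half the central coefficient of \<open>(1 + x\<^sup>2 + 2x)\<^sup>2\<^sup>k\<^sup>-\<^sup>1\<close>. The two contributions have a nonzero sum for
  \<open>k \<ge> 2\<close>, since the squares in row \<open>2k - 1\<close> of the Pascal triangle sum to
  \<open>(4k - 2) choose (2k - 1)\<close> and the two middle ones do not exhaust that sum
  (\<open>central_binomial_gt\<close>). For \<open>k = 1\<close> both sides
  vanish identically.
\<close>

section \<open>Gap lists and pairs of increasing sequences\<close>

text \<open>
  The entries are pairs (indices of the first sequence only, indices of the second sequence only).
\<close>

definition gap_lists :: "nat \<Rightarrow> nat \<Rightarrow> nat \<Rightarrow> (nat \<times> nat) list set" where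
  "gap_lists r a b = {g. length g = r \<and> sum_list (map fst g) = a \<and> sum_list (map snd g) = b}"

definition shuffle_count :: "(nat \<times> nat) list \<Rightarrow> nat" where
  "shuffle_count g = (\<Prod>(a, b)\<leftarrow>g. (a + b) choose a)"

lemma shuffle_count_simps [simp]:
  "shuffle_count [] = 1" "shuffle_count ((a, b) # g) = ((a + b) choose a) * shuffle_count g"
  by (simp_all add: shuffle_count_def)

lemma gap_lists_0: "gap_lists 0 a b = (if a = 0 \<and> b = 0 then {[]} else {})"
  by (auto simp: gap_lists_def)

lemma gap_lists_Suc:
  "gap_lists (Suc r) a b = (\<Union>(i, j)\<in>{..a} \<times> {..b}. Cons (i, j) ` gap_lists r (a - i) (b - j))"
proof (intro equalityI subsetI)
  fix g assume "g \<in> gap_lists (Suc r) a b"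
  then obtain i j g' where "g = (i, j) # g'" "length g' = r"
      "i + sum_list (map fst g') = a" "j + sum_list (map snd g') = b"
    by (cases g) (auto simp: gap_lists_def)
  then show "g \<in> (\<Union>(i, j)\<in>{..a} \<times> {..b}. Cons (i, j) ` gap_lists r (a - i) (b - j))"
    by (force simp: gap_lists_def)
qed (auto simp: gap_lists_def)

lemma finite_gap_lists [simp]: "finite (gap_lists r a b)"
  by (induction r arbitrary: a b) (auto simp: gap_lists_0 gap_lists_Suc)

fun add_left :: "(nat \<times> nat) list \<Rightarrow> (nat \<times> nat) list" where
  "add_left [] = []"
| "add_left ((i, j) # g) = (Suc i, j) # g"

fun add_right :: "(nat \<times> nat) list \<Rightarrow> (nat \<times> nat) list" where
  "add_right [] = []"
| "add_right ((i, j) # g) = (i, Suc j) # g"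

text \<open>
  Elements private to one list are counted in the gap that they lie in, and a common element closes
  the gap. The recursion tests membership and never compares two elements. The last branch removes
  one element of each list, which is the intended step: two strictly sorted lists whose heads each
  occur in the other list have equal heads.
\<close>

fun gaps :: "'a list \<Rightarrow> 'a list \<Rightarrow> (nat \<times> nat) list" where
  "gaps [] bs = [(0, length bs)]"
| "gaps (a # as) [] = add_left (gaps as [])"
| "gaps (a # as) (b # bs) =
     (if a \<notin> set (b # bs) then add_left (gaps as (b # bs))
      else if b \<notin> set (a # as) then add_right (gaps (a # as) bs)
      else (0, 0) # gaps as bs)"

lemma add_left_eq_Nil_iff [simp]: "add_left g = [] \<longleftrightarrow> g = []"
  and add_right_eq_Nil_iff [simp]: "add_right g = [] \<longleftrightarrow> g = []"
  and add_left_add_right: "add_left (add_right g) = add_right (add_left g)"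
  by (cases g; auto)+

lemma gaps_neq_Nil [simp]: "gaps as bs \<noteq> []"
  by (induction as bs rule: gaps.induct) auto

lemma gaps_Cons_left: "a \<notin> set bs \<Longrightarrow> gaps (a # as) bs = add_left (gaps as bs)"
  by (cases bs) auto

text \<open>
  The definition strips private elements of the first list before those of the second. This lemma
  makes the two lists interchangeable: increments of the two components commute.
\<close>

lemma gaps_Cons_right: "b \<notin> set as \<Longrightarrow> gaps as (b # bs) = add_right (gaps as bs)"
proof (induction as)
  case (Cons a as)
  then show ?case
    using gaps_Cons_left[of a bs as] by (auto simp: add_left_add_right)
qed simp

lemma gaps_Cons_both: "gaps (a # as) (a # bs) = (0, 0) # gaps as bs"
  by simp

text \<open>
  If the second list is empty or starts with a common element, nothing of it lies in the first gap.
\<close>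

lemma snd_hd_gaps: "bs = [] \<or> hd bs \<in> set as \<Longrightarrow> snd (hd (gaps as bs)) = 0"
proof (induction as)
  case (Cons a as)
  have "snd (hd (add_left g)) = snd (hd g)" for g by (cases g) auto
  with Cons show ?case by (cases bs) auto
qed auto

lemma fst_hd_gaps: "as = [] \<or> hd as \<in> set bs \<Longrightarrow> fst (hd (gaps as bs)) = 0"
proof (induction bs)
  case (Cons b bs)
  have add_right: "fst (hd (add_right g)) = fst (hd g)" for g by (cases g) auto
  show ?case
  proof (cases "b \<in> set as")
    case True
    with Cons.prems show ?thesis by (cases as) (auto split: if_splits)
  next
    case False
    with Cons show ?thesis by (cases as) (auto simp: gaps_Cons_right add_right)
  qed
qed auto

lemma sum_fst_gaps: "sum_list (map fst (gaps as bs)) + length (gaps as bs) = Suc (length as)"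
  and sum_snd_gaps: "sum_list (map snd (gaps as bs)) + length (gaps as bs) = Suc (length bs)"
proof -
  have l: "g \<noteq> [] \<Longrightarrow> sum_list (map fst (add_left g)) = Suc (sum_list (map fst g))"
       "sum_list (map snd (add_left g)) = sum_list (map snd g)" "length (add_left g) = length g" for g
    by (cases g; auto)+
  have r: "g \<noteq> [] \<Longrightarrow> sum_list (map snd (add_right g)) = Suc (sum_list (map snd g))"
       "sum_list (map fst (add_right g)) = sum_list (map fst g)" "length (add_right g) = length g" for g
    by (cases g; auto)+
  show "sum_list (map fst (gaps as bs)) + length (gaps as bs) = Suc (length as)"
    by (induction as bs rule: gaps.induct) (simp_all add: l r)
  show "sum_list (map snd (gaps as bs)) + length (gaps as bs) = Suc (length bs)"
    by (induction as bs rule: gaps.induct) (simp_all add: l r)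
qed

text \<open>
  A shuffle starts with the head of one of the two lists, unless that head is a common element still
  preceded by something in the other list. When both heads are private this is the rule of Pascal for
  the first gap; when only one is, the first gap has an empty component and its binomial coefficient
  stays 1.
\<close>

lemma shuffle_count_gaps_rec:
  fixes as bs :: "'a::linorder list"
  assumes "sorted_wrt (<) as" "sorted_wrt (<) bs" "as \<noteq> [] \<or> bs \<noteq> []"
  shows "shuffle_count (gaps as bs) =
     (if as \<noteq> [] \<and> hd as \<notin> set bs then shuffle_count (gaps (tl as) bs) else 0)
   + (if bs \<noteq> [] \<and> hd bs \<notin> set as then shuffle_count (gaps as (tl bs)) else 0)
   + (if as \<noteq> [] \<and> bs \<noteq> [] \<and> hd as = hd bs then shuffle_count (gaps (tl as) (tl bs)) else 0)"
proof -
  have l: "snd (hd g) = 0 \<Longrightarrow> shuffle_count (add_left g) = shuffle_count g"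
    and r: "fst (hd g) = 0 \<Longrightarrow> shuffle_count (add_right g) = shuffle_count g"
    and lr: "g \<noteq> [] \<Longrightarrow> shuffle_count (add_left (add_right g)) = shuffle_count (add_right g) + shuffle_count (add_left g)" for g
    by (cases g; auto simp: algebra_simps)+
  consider (both) a as' b bs' where "as = a # as'" "bs = b # bs'" "a \<notin> set bs" "b \<notin> set as"
    | (left) a as' where "as = a # as'" "a \<notin> set bs" "bs = [] \<or> hd bs \<in> set as"
    | (right) b bs' where "bs = b # bs'" "b \<notin> set as" "as = [] \<or> hd as \<in> set bs"
    | (eq) a as' bs' where "as = a # as'" "bs = a # bs'"
  proof (cases as; cases bs)
    fix a as' b bs' assume *: "as = a # as'" "bs = b # bs'"
    have "a = b" if "a \<in> set bs" "b \<in> set as"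
      using * assms that by (auto dest: less_trans)
    with * that show ?thesis by (metis list.sel(1))
  qed (use assms that in auto)
  then show ?thesis
  proof cases
    case both
    then have "shuffle_count (gaps as bs) = shuffle_count (add_left (add_right (gaps as' bs')))"
      by (simp add: gaps_Cons_left gaps_Cons_right)
    then show ?thesis
      using both by (auto simp: lr gaps_Cons_left gaps_Cons_right simp del: gaps.simps)
  next
    case left
    then have "bs = [] \<or> hd bs \<in> set as'" by (cases bs) auto
    then have "shuffle_count (gaps as bs) = shuffle_count (gaps as' bs)"
      using left by (simp add: gaps_Cons_left l snd_hd_gaps)
    then show ?thesis using left by (cases bs) auto
  next
    case right
    then have "as = [] \<or> hd as \<in> set bs'" by (cases as) auto
    then have "shuffle_count (gaps as bs) = shuffle_count (gaps as bs')"
      using right by (simp add: gaps_Cons_right r fst_hd_gaps)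
    then show ?thesis using right by (cases as) auto
  next
    case eq
    then show ?thesis by simp
  qed
qed

section \<open>Counting the orders compatible with two chains\<close>

text \<open>
  The enumerations of \<open>X\<close> in which the elements of \<open>as\<close> and those of \<open>bs\<close> come in the order of these
  lists. A permutation will be represented by its inverse, written as the list of the positions in
  the order of their values; increasing on \<open>as\<close> then means that filtering returns \<open>as\<close>.
\<close>

definition linear_extensions :: "'a set \<Rightarrow> 'a list \<Rightarrow> 'a list \<Rightarrow> 'a list set" where
  "linear_extensions X as bs = {xs \<in> permutations_of_set X.
     filter (\<lambda>x. x \<in> set as) xs = as \<and> filter (\<lambda>x. x \<in> set bs) xs = bs}"

text \<open>
  Classify the enumerations by their first element. It is either outside both lists, or it is the
  head of each list that contains it.
\<close>

lemma card_linear_extensions_rec: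
  fixes as bs :: "'a list"
  assumes "finite X" "X \<noteq> {}" "set as \<subseteq> X" "set bs \<subseteq> X" "distinct as" "distinct bs"
  shows "card (linear_extensions X as bs) =
     (\<Sum>x\<in>X - (set as \<union> set bs). card (linear_extensions (X - {x}) as bs))
   + (if as \<noteq> [] \<and> hd as \<notin> set bs then card (linear_extensions (X - {hd as}) (tl as) bs) else 0)
   + (if bs \<noteq> [] \<and> hd bs \<notin> set as then card (linear_extensions (X - {hd bs}) as (tl bs)) else 0)
   + (if as \<noteq> [] \<and> bs \<noteq> [] \<and> hd as = hd bs then card (linear_extensions (X - {hd as}) (tl as) (tl bs)) else 0)"
proof -
  \<comment> \<open>the tails of the enumerations that start with \<open>x\<close>\<close>
  define S where "S x = {xs \<in> permutations_of_set (X - {x}).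
     filter (\<lambda>x. x \<in> set as) (x # xs) = as \<and> filter (\<lambda>x. x \<in> set bs) (x # xs) = bs}" for x
  have fin: "finite (S x)" for x
    unfolding S_def by simp
  have "linear_extensions X as bs = (\<Union>x\<in>X. Cons x ` S x)"
  proof (intro equalityI subsetI)
    fix xs assume "xs \<in> linear_extensions X as bs"
    then show "xs \<in> (\<Union>x\<in>X. Cons x ` S x)"
      unfolding linear_extensions_def permutations_of_set_nonempty[OF assms(2)] S_def
      by (simp del: filter.simps) blast
  next
    fix xs assume "xs \<in> (\<Union>x\<in>X. Cons x ` S x)"
    then obtain x ys where "x \<in> X" "ys \<in> S x" "xs = x # ys"
      by blast
    then show "xs \<in> linear_extensions X as bs"
      unfolding linear_extensions_def permutations_of_set_nonempty[OF assms(2)] by (auto simp: S_def)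
  qed
  then have "card (linear_extensions X as bs) = (\<Sum>x\<in>X. card (Cons x ` S x))"
    using assms(1) fin by (subst card_UN_disjoint[symmetric]) auto
  also have "\<dots> = (\<Sum>x\<in>X. card (S x))"
    by (simp add: card_image)
  also have "\<dots> = (\<Sum>x\<in>X - (set as \<union> set bs). card (S x)) + (\<Sum>x\<in>set as \<union> set bs. card (S x))"
    using assms by (intro sum.subset_diff) auto
  also have "(\<Sum>x\<in>X - (set as \<union> set bs). card (S x)) =
      (\<Sum>x\<in>X - (set as \<union> set bs). card (linear_extensions (X - {x}) as bs))"
    by (intro sum.cong) (auto simp: S_def linear_extensions_def)
  also have "(\<Sum>x\<in>set as \<union> set bs. card (S x)) =
      (\<Sum>x\<in>set as \<union> set bs.
       (if as \<noteq> [] \<and> x = hd as \<and> x \<notin> set bs then card (linear_extensions (X - {x}) (tl as) bs) else 0)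
     + (if bs \<noteq> [] \<and> x = hd bs \<and> x \<notin> set as then card (linear_extensions (X - {x}) as (tl bs)) else 0)
     + (if as \<noteq> [] \<and> bs \<noteq> [] \<and> x = hd as \<and> hd as = hd bs then card (linear_extensions (X - {x}) (tl as) (tl bs)) else 0))"
  proof (rule sum.cong[OF refl])
    fix x assume x: "x \<in> set as \<union> set bs"
    \<comment> \<open>\<open>x\<close> does not recur in the tail, so removing it from a list does not change the filter\<close>
    have flt: "filter (\<lambda>y. y = x \<or> y \<in> B) xs = filter (\<lambda>y. y \<in> B) xs"
      if "xs \<in> permutations_of_set (X - {x})" for xs B
      using that by (intro filter_cong) (auto dest: permutations_of_setD)
    have head: "S x = {}" if "cs = as \<or> cs = bs" "x \<in> set cs" "cs = [] \<or> hd cs \<noteq> x" for cs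
    proof (rule equals0I)
      fix xs assume "xs \<in> S x"
      then have "filter (\<lambda>y. y \<in> set cs) (x # xs) = cs"
        using that(1) unfolding S_def by blast
      then have "cs = x # filter (\<lambda>y. y \<in> set cs) xs"
        using that(2) by simp
      with that(3) show False by (metis list.sel(1) list.distinct(1))
    qed
    consider (l) as' where "as = x # as'" "x \<notin> set bs"
      | (r) bs' where "bs = x # bs'" "x \<notin> set as"
      | (b) as' bs' where "as = x # as'" "bs = x # bs'"
      | (none) cs where "cs = as \<or> cs = bs" "x \<in> set cs" "cs = [] \<or> hd cs \<noteq> x"
    proof -
      show thesis
      proof (cases "\<exists>cs. (cs = as \<or> cs = bs) \<and> x \<in> set cs \<and> (cs = [] \<or> hd cs \<noteq> x)")
        case True
        then show thesis using that(4) by blast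
      next
        case False
        then have "x \<in> set cs \<Longrightarrow> cs \<noteq> [] \<and> hd cs = x" if "cs = as \<or> cs = bs" for cs
          using that by blast
        then have a: "x \<in> set as \<Longrightarrow> \<exists>as'. as = x # as'" and b: "x \<in> set bs \<Longrightarrow> \<exists>bs'. bs = x # bs'"
          by (metis list.exhaust_sel)+
        show thesis
        proof (cases "x \<in> set as"; cases "x \<in> set bs")
          assume "x \<in> set as" "x \<in> set bs"
          with a b show thesis using that(3) by metis
        next
          assume "x \<in> set as" "x \<notin> set bs"
          with a show thesis using that(1) by metis
        next
          assume "x \<notin> set as" "x \<in> set bs"
          with b show thesis using that(2) by metis
        qed (use x in simp)
      qed
    qed
    then show "card (S x) =
       (if as \<noteq> [] \<and> x = hd as \<and> x \<notin> set bs then card (linear_extensions (X - {x}) (tl as) bs) else 0)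
     + (if bs \<noteq> [] \<and> x = hd bs \<and> x \<notin> set as then card (linear_extensions (X - {x}) as (tl bs)) else 0)
     + (if as \<noteq> [] \<and> bs \<noteq> [] \<and> x = hd as \<and> hd as = hd bs then card (linear_extensions (X - {x}) (tl as) (tl bs)) else 0)"
    proof cases
      case l
      then have "S x = linear_extensions (X - {x}) as' bs"
        by (auto simp: S_def linear_extensions_def flt)
      moreover have "bs \<noteq> [] \<Longrightarrow> x \<noteq> hd bs" using l by (metis hd_in_set)
      ultimately show ?thesis using l by (cases "bs = []") simp_all
    next
      case r
      then have "S x = linear_extensions (X - {x}) as bs'"
        by (auto simp: S_def linear_extensions_def flt)
      moreover have "as \<noteq> [] \<Longrightarrow> x \<noteq> hd as" using r by (metis hd_in_set)
      ultimately show ?thesis using r by (cases "as = []") simp_all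
    next
      case b
      then have "S x = linear_extensions (X - {x}) as' bs'"
        by (auto simp: S_def linear_extensions_def flt)
      then show ?thesis using b by simp
    next
      case none
      then have "S x = {}" by (rule head)
      moreover have "\<not> (as \<noteq> [] \<and> x = hd as \<and> x \<notin> set bs)" "\<not> (bs \<noteq> [] \<and> x = hd bs \<and> x \<notin> set as)"
        "\<not> (as \<noteq> [] \<and> bs \<noteq> [] \<and> x = hd as \<and> hd as = hd bs)"
        using none by (metis hd_in_set)+
      ultimately show ?thesis by (simp only: if_False card.empty add_0_left)
    qed
  qed
  also have "\<dots> =
     (if as \<noteq> [] \<and> hd as \<notin> set bs then card (linear_extensions (X - {hd as}) (tl as) bs) else 0)
   + (if bs \<noteq> [] \<and> hd bs \<notin> set as then card (linear_extensions (X - {hd bs}) as (tl bs)) else 0)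
   + (if as \<noteq> [] \<and> bs \<noteq> [] \<and> hd as = hd bs then card (linear_extensions (X - {hd as}) (tl as) (tl bs)) else 0)"
  proof -
    have *: "(\<Sum>x\<in>set as \<union> set bs. if P \<and> x = y \<and> Q x then f x else 0) = (if P \<and> Q y then f y else (0::nat))"
      if "P \<Longrightarrow> y \<in> set as \<union> set bs" for P y Q f
    proof (cases "P \<and> Q y")
      case True
      then have "(\<Sum>x\<in>set as \<union> set bs. if P \<and> x = y \<and> Q x then f x else 0) =
        (\<Sum>x\<in>set as \<union> set bs. if x = y then f x else 0)"
        by (intro sum.cong) auto
      with True that show ?thesis by (simp add: sum.delta)
    qed (auto intro!: sum.neutral)
    show ?thesis
      unfolding sum.distrib
      by (rule arg_cong2[of _ _ _ _ "(+)"], rule arg_cong2[of _ _ _ _ "(+)"],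
          rule *[where P = "as \<noteq> []" and Q = "\<lambda>x. x \<notin> set bs"], simp,
          rule *[where P = "bs \<noteq> []" and Q = "\<lambda>x. x \<notin> set as"], simp,
          rule *[where P = "as \<noteq> [] \<and> bs \<noteq> []" and Q = "\<lambda>_. hd as = hd bs", unfolded conj_assoc], simp)
  qed
  finally show ?thesis by (simp only: add.assoc)
qed

text \<open>
  The fraction of enumerations of \<open>X\<close> that respect both lists depends only on the relative order on
  the union of the lists. Induction on \<open>n + 1 = card X\<close>: let \<open>N\<close> be the size of the union and \<open>r\<close> the
  number \<open>n! * shuffle_count / N!\<close>. Each of the \<open>n + 1 - N\<close> first elements outside the union leaves
  \<open>r\<close> enumerations by the induction hypothesis, and those inside leave \<open>N r\<close> together by
  \<open>shuffle_count_gaps_rec\<close>, which makes \<open>(n + 1) r\<close>.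
\<close>

lemma card_linear_extensions:
  fixes as bs :: "'a::linorder list"
  assumes "finite X" "set as \<subseteq> X" "set bs \<subseteq> X" "sorted_wrt (<) as" "sorted_wrt (<) bs"
  shows "card (linear_extensions X as bs) * fact (card (set as \<union> set bs)) = fact (card X) * shuffle_count (gaps as bs)"
  using assms
proof (induction "card X" arbitrary: X as bs)
  case 0
  then show ?case by (simp add: linear_extensions_def)
next
  case (Suc n)
  let ?V = "set as \<union> set bs"
  have dist: "distinct as" "distinct bs"
    using Suc.prems by (simp_all add: strict_sorted_iff)
  have X: "X \<noteq> {}" using Suc.hyps by auto
  have cardX: "n = card (X - {x})" if "x \<in> X" for x
    using that Suc.hyps(2) Suc.prems(1) by simp
  have outside: "(\<Sum>x\<in>X - ?V. card (linear_extensions (X - {x}) as bs)) * fact (card ?V) =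
      (Suc n - card ?V) * (fact n * shuffle_count (gaps as bs))"
  proof -
    have "card (linear_extensions (X - {x}) as bs) * fact (card ?V) = fact n * shuffle_count (gaps as bs)"
      if "x \<in> X - ?V" for x
      using Suc.hyps(1)[of "X - {x}" as bs] cardX[of x] that Suc.prems by auto
    moreover have "card (X - ?V) = Suc n - card ?V"
      using Suc.prems Suc.hyps(2) by (subst card_Diff_subset) auto
    ultimately show ?thesis by (simp add: sum_distrib_right)
  qed
  show ?case
  proof (cases "as = [] \<and> bs = []")
    case True
    then have "linear_extensions X as bs = permutations_of_set X"
      by (auto simp: linear_extensions_def)
    with True Suc.prems show ?thesis by simp
  next
    case False
    then have "card ?V \<noteq> 0" by auto
    then obtain N where N: "card ?V = Suc N" using not0_implies_Suc by blast
    have le: "Suc N \<le> Suc n"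
      using Suc.prems Suc.hyps(2) N card_mono[of X ?V] by simp
    let ?l = "as \<noteq> [] \<and> hd as \<notin> set bs" and ?r = "bs \<noteq> [] \<and> hd bs \<notin> set as"
      and ?b = "as \<noteq> [] \<and> bs \<noteq> [] \<and> hd as = hd bs"
    have l: "card (linear_extensions (X - {hd as}) (tl as) bs) * fact N = fact n * shuffle_count (gaps (tl as) bs)" if c: ?l
    proof -
      obtain a as' where [simp]: "as = a # as'" using c by (cases as) auto
      have "set as' \<union> set bs = ?V - {a}" using c dist by auto
      moreover have "card (?V - {a}) = N" using N by (subst card_Diff_singleton) auto
      ultimately have "card (set as' \<union> set bs) = N" by simp
      with Suc.hyps(1)[of "X - {a}" as' bs] cardX[of a] c Suc.prems dist show ?thesis by auto
    qed
    have r: "card (linear_extensions (X - {hd bs}) as (tl bs)) * fact N = fact n * shuffle_count (gaps as (tl bs))" if c: ?r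
    proof -
      obtain b bs' where [simp]: "bs = b # bs'" using c by (cases bs) auto
      have "set as \<union> set bs' = ?V - {b}" using c dist by auto
      moreover have "card (?V - {b}) = N" using N by (subst card_Diff_singleton) auto
      ultimately have "card (set as \<union> set bs') = N" by simp
      with Suc.hyps(1)[of "X - {b}" as bs'] cardX[of b] c Suc.prems dist show ?thesis by auto
    qed
    have b: "card (linear_extensions (X - {hd as}) (tl as) (tl bs)) * fact N = fact n * shuffle_count (gaps (tl as) (tl bs))" if c: ?b
    proof -
      obtain a as' bs' where [simp]: "as = a # as'" "bs = a # bs'"
        using c by (cases as; cases bs) auto
      have "set as' \<union> set bs' = ?V - {a}" using dist by auto
      moreover have "card (?V - {a}) = N" using N by (subst card_Diff_singleton) auto
      ultimately have "card (set as' \<union> set bs') = N" by simp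
      with Suc.hyps(1)[of "X - {a}" as' bs'] cardX[of a] c Suc.prems dist show ?thesis by auto
    qed
    define heads where "heads =
          (if ?l then card (linear_extensions (X - {hd as}) (tl as) bs) else 0)
        + (if ?r then card (linear_extensions (X - {hd bs}) as (tl bs)) else 0)
        + (if ?b then card (linear_extensions (X - {hd as}) (tl as) (tl bs)) else 0)"
    have heads: "heads * fact N = fact n * shuffle_count (gaps as bs)"
    proof -
      have scale: "(if P then u else 0) * c = m * (if P then v else 0)"
        if "P \<Longrightarrow> u * c = m * v" for P and u v c m :: nat
        using that by (cases P) auto
      show ?thesis
        unfolding heads_def shuffle_count_gaps_rec[OF Suc.prems(4,5) False[unfolded de_Morgan_conj]] distrib_right distrib_left
        by (rule arg_cong2[of _ _ _ _ "(+)"], rule arg_cong2[of _ _ _ _ "(+)"], rule scale, rule l, assumption,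
            rule scale, rule r, assumption, rule scale, rule b, assumption)
    qed
    have "heads * fact (Suc N) = Suc N * (heads * fact N)"
      by (simp only: fact_Suc of_nat_id mult.left_commute)
    moreover have "card (linear_extensions X as bs) = (\<Sum>x\<in>X - ?V. card (linear_extensions (X - {x}) as bs)) + heads"
      unfolding card_linear_extensions_rec[OF Suc.prems(1) X Suc.prems(2,3) dist] heads_def by (simp only: add.assoc)
    ultimately have "card (linear_extensions X as bs) * fact (card ?V) =
        (Suc n - Suc N) * (fact n * shuffle_count (gaps as bs)) + Suc N * (fact n * shuffle_count (gaps as bs))"
      using outside by (simp only: N heads distrib_right)
    also have "\<dots> = Suc n * (fact n * shuffle_count (gaps as bs))"
      using le by (simp only: distrib_right[symmetric] le_add_diff_inverse2)
    finally show ?thesis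
      unfolding Suc.hyps(2)[symmetric] by (simp only: fact_Suc of_nat_id mult.assoc)
  qed
qed

section \<open>Counting pairs of index tuples with given gaps\<close>

text \<open>
  The size of the union of two lists with the given gaps; the common elements are one fewer than the
  gaps, whence the subtraction.
\<close>

definition gap_size :: "(nat \<times> nat) list \<Rightarrow> nat" where
  "gap_size g = sum_list (map fst g) + sum_list (map snd g) + length g - 1"

definition pairs_with_gaps :: "'a list \<Rightarrow> (nat \<times> nat) list \<Rightarrow> ('a list \<times> 'a list) set" where
  "pairs_with_gaps xs g = {(as, bs). subseq as xs \<and> subseq bs xs \<and> gaps as bs = g}"

lemma finite_pairs_with_gaps [simp]: "finite (pairs_with_gaps xs g)"
proof (rule finite_subset)
  show "pairs_with_gaps xs g \<subseteq> set (List.subseqs xs) \<times> set (List.subseqs xs)"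
    by (auto simp: pairs_with_gaps_def)
qed simp

lemma subseq_Cons_iff: "subseq as (x # xs) \<longleftrightarrow> subseq as xs \<or> (\<exists>as'. as = x # as' \<and> subseq as' xs)"
  by (cases as) (auto simp: subseq_Cons2_iff dest: subseq_Cons')

text \<open>
  Adding a new first element \<open>x\<close> to the ground list leaves four possibilities: \<open>x\<close> is in neither
  list, in one of them, or in both. The last three shrink the gap list in the three ways in which a
  shuffle can start, so their number is governed by \<open>shuffle_count\<close>, and the factor counting the
  unions obeys the rule of Pascal.
\<close>

lemma card_pairs_with_gaps:
  assumes "distinct xs" "g \<noteq> []"
  shows "card (pairs_with_gaps xs g) = (length xs choose gap_size g) * shuffle_count g"
  using assms
proof (induction xs arbitrary: g)
  case Nil
  then obtain i j g' where g: "g = (i, j) # g'" by (cases g) auto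
  show ?case
  proof (cases "g = [(0, 0)]")
    case True
    then have "pairs_with_gaps ([] :: 'a list) g = {([], [])}"
      by (auto simp: pairs_with_gaps_def)
    with True show ?thesis by (simp add: gap_size_def)
  next
    case False
    then have "pairs_with_gaps ([] :: 'a list) g = {}" "gap_size g > 0"
      using g by (auto simp: pairs_with_gaps_def gap_size_def dest!: list_emb_Nil2)
    then show ?thesis by simp
  qed
next
  case (Cons x xs)
  obtain i j g' where g: "g = (i, j) # g'" using Cons.prems by (cases g) auto
  let ?P = "pairs_with_gaps xs"
  have x: "x \<notin> set as" if "subseq as xs" for as
    using that Cons.prems by (auto elim!: list_emb_set)
  have add_left: "add_left h = (i, j) # g' \<longleftrightarrow> i > 0 \<and> h = (i - 1, j) # g'" for h i j and g' :: "(nat \<times> nat) list"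
    by (cases h) auto
  have add_right: "add_right h = (i, j) # g' \<longleftrightarrow> j > 0 \<and> h = (i, j - 1) # g'" for h i j and g' :: "(nat \<times> nat) list"
    by (cases h) auto
  \<comment> \<open>\<open>x\<close> in the first list only, in the second only, in both\<close>
  define A where "A = (if i > 0 then (\<lambda>(as, bs). (x # as, bs)) ` ?P ((i - 1, j) # g') else {})"
  define B where "B = (if j > 0 then (\<lambda>(as, bs). (as, x # bs)) ` ?P ((i, j - 1) # g') else {})"
  define C where "C = (if i = 0 \<and> j = 0 then (\<lambda>(as, bs). (x # as, x # bs)) ` ?P g' else {})"
  have A_eq: "A = {(x # as, bs) |as bs. subseq as xs \<and> subseq bs xs \<and> gaps (x # as) bs = g}"
    unfolding A_def pairs_with_gaps_def g using x
    by (auto simp: gaps_Cons_left add_left image_iff simp del: gaps.simps)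
  have B_eq: "B = {(as, x # bs) |as bs. subseq as xs \<and> subseq bs xs \<and> gaps as (x # bs) = g}"
    unfolding B_def pairs_with_gaps_def g using x
    by (auto simp: gaps_Cons_right add_right image_iff simp del: gaps.simps)
  have C_eq: "C = {(x # as, x # bs) |as bs. subseq as xs \<and> subseq bs xs \<and> gaps (x # as) (x # bs) = g}"
    unfolding C_def pairs_with_gaps_def g
    by (auto simp: gaps_Cons_both image_iff simp del: gaps.simps)
  have "pairs_with_gaps (x # xs) g = ?P g \<union> (A \<union> (B \<union> C))"
    unfolding A_eq B_eq C_eq pairs_with_gaps_def subseq_Cons_iff by blast
  moreover have "?P g \<inter> (A \<union> (B \<union> C)) = {}" "A \<inter> (B \<union> C) = {}" "B \<inter> C = {}"
    by (auto simp: A_def B_def C_def pairs_with_gaps_def x dest: x split: if_splits)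
  moreover have "finite A" "finite B" "finite C" by (auto simp: A_def B_def C_def)
  ultimately have card: "card (pairs_with_gaps (x # xs) g) = card (?P g) + (card A + (card B + card C))"
    by (simp add: card_Un_disjoint)
  have cardA: "card A = (if i > 0 then card (?P ((i - 1, j) # g')) else 0)"
    and cardB: "card B = (if j > 0 then card (?P ((i, j - 1) # g')) else 0)"
    and cardC: "card C = (if i = 0 \<and> j = 0 then card (?P g') else 0)"
    by (auto simp: A_def B_def C_def intro!: card_image inj_onI)
  have P_Nil: "?P [] = {}" by (auto simp: pairs_with_gaps_def)
  note IH = Cons.IH[OF distinct.simps(2)[THEN iffD1, THEN conjunct2, OF Cons.prems(1)]]
  show ?case
  proof (cases "gap_size g")
    case 0
    then have "g = [(0, 0)]" using g by (auto simp: gap_size_def)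
    then show ?thesis
      using g IH[of g] 0 unfolding card cardA cardB cardC by (simp add: P_Nil)
  next
    case (Suc N)
    have A': "card A = (length xs choose N) * (if i > 0 then shuffle_count ((i - 1, j) # g') else 0)"
      using Suc IH[of "(i - 1, j) # g'"] unfolding cardA g gap_size_def by auto
    have B': "card B = (length xs choose N) * (if j > 0 then shuffle_count ((i, j - 1) # g') else 0)"
      using Suc IH[of "(i, j - 1) # g'"] unfolding cardB g gap_size_def by auto
    have C': "card C = (length xs choose N) * (if i = 0 \<and> j = 0 then shuffle_count g' else 0)"
    proof (cases "g' = []")
      case True
      with Suc show ?thesis unfolding cardC g gap_size_def by (auto simp: P_Nil)
    next
      case False
      with Suc IH[of g'] show ?thesis unfolding cardC g gap_size_def by (auto simp: neq_Nil_conv)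
    qed
    have pascal: "shuffle_count g = (if i > 0 then shuffle_count ((i - 1, j) # g') else 0)
        + ((if j > 0 then shuffle_count ((i, j - 1) # g') else 0) + (if i = 0 \<and> j = 0 then shuffle_count g' else 0))"
      unfolding g by (cases i; cases j) (simp_all add: algebra_simps)
    have "card A + (card B + card C) = (length xs choose N) * shuffle_count g"
      unfolding A' B' C' pascal by (simp only: distrib_left)
    then have "card (pairs_with_gaps (x # xs) g) = (length xs choose Suc N) * shuffle_count g + (length xs choose N) * shuffle_count g"
      unfolding card using IH[of g] Suc g by simp
    then show ?thesis using Suc by (simp add: algebra_simps)
  qed
qed

section \<open>The two moments as sums over gap lists\<close>

lemma gaps_Nil_right: "gaps as [] = [(length as, 0)]"
  by (induction as) auto

text \<open>
  In strictly sorted lists the branch that closes a gap is taken once for each common element, and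
  the last gap stays open.
\<close>

lemma length_gaps:
  fixes as bs :: "'a::linorder list"
  assumes "sorted_wrt (<) as" "sorted_wrt (<) bs"
  shows "length (gaps as bs) = Suc (card (set as \<inter> set bs))"
  using assms
proof (induction as bs rule: gaps.induct)
  case (2 a as)
  then show ?case by (simp add: gaps_Nil_right)
next
  case (3 a as b bs)
  have len: "length (add_left g) = length g" "length (add_right g) = length g" for g
    by (cases g; auto)+
  consider "a \<notin> set (b # bs)" | "a \<in> set (b # bs)" "b \<notin> set (a # as)" | "a \<in> set (b # bs)" "b \<in> set (a # as)"
    by blast
  then show ?case
  proof cases
    case 1
    then show ?thesis using 3 by (simp add: len)
  next
    case 2
    then show ?thesis using 3 by (simp add: len)
  next
    case both: 3
    have "a = b" using both "3.prems" by (auto dest: less_trans)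
    moreover from this have "set (a # as) \<inter> set (b # bs) = insert a (set as \<inter> set bs)" "a \<notin> set as \<inter> set bs"
      using "3.prems" by auto
    ultimately show ?thesis using "3.IH"(3) both "3.prems" by simp
  qed
qed simp

lemma gap_size_gaps:
  fixes as bs :: "'a::linorder list"
  assumes "sorted_wrt (<) as" "sorted_wrt (<) bs"
  shows "gap_size (gaps as bs) = card (set as \<union> set bs)"
proof -
  have "card (set as) = length as" "card (set bs) = length bs"
    using assms by (simp_all add: strict_sorted_iff distinct_card)
  then have "card (set as \<union> set bs) + card (set as \<inter> set bs) = length as + length bs"
    using card_Un_Int[of "set as" "set bs"] by simp
  then show ?thesis
    using length_gaps[OF assms] sum_fst_gaps[of as bs] sum_snd_gaps[of as bs]
    unfolding gap_size_def by simp
qed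

lemma index_tuples_eq_subseq: "index_tuples n k = {is. subseq is [1..<Suc n] \<and> length is = k}"
proof -
  have "subseq is [1..<Suc n] \<longleftrightarrow> set is \<subseteq> {1..n} \<and> sorted_wrt (<) is" for "is"
  proof
    assume "subseq is [1..<Suc n]"
    then obtain N where "is = nths [1..<Suc n] N" by (auto simp: subseq_conv_nths)
    moreover have "sorted_wrt (<) (nths xs N)" if "sorted_wrt (<) xs" for xs :: "nat list" and N
      using that by (induction xs arbitrary: N) (auto simp: nths_Cons dest: in_set_nthsD)
    ultimately show "set is \<subseteq> {1..n} \<and> sorted_wrt (<) is"
      using set_nths_subset[of "[1..<Suc n]" N] by (auto simp del: upt_Suc)
  next
    assume "set is \<subseteq> {1..n} \<and> sorted_wrt (<) is"
    then show "subseq is [1..<Suc n]"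
      by (intro sorted_subset_imp_subseq) (auto simp: strict_sorted_iff simp del: upt_Suc)
  qed
  then show ?thesis by (auto simp: index_tuples_def)
qed

lemma finite_index_tuples [simp]: "finite (index_tuples n k)"
  by (rule finite_subset[of _ "set (List.subseqs [1..<Suc n])"]) (auto simp: index_tuples_eq_subseq)

text \<open>
  Taking the second list empty turns the count of pairs into a count of single tuples.
\<close>

lemma card_index_tuples: "card (index_tuples n k) = n choose k"
proof -
  have Nil: "length as = k \<and> bs = []" if "gaps as bs = [(k, 0)]" for as bs :: "nat list"
    using that sum_fst_gaps[of as bs] sum_snd_gaps[of as bs] by simp
  have "pairs_with_gaps [1..<Suc n] [(k, 0)] = (\<lambda>as. (as, [])) ` index_tuples n k"
    by (auto simp: pairs_with_gaps_def index_tuples_eq_subseq gaps_Nil_right dest: Nil simp del: upt_Suc)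
  then have "card (index_tuples n k) = card (pairs_with_gaps [1..<Suc n] [(k, 0)])"
    by (simp add: card_image inj_on_def)
  also have "\<dots> = n choose k"
    by (subst card_pairs_with_gaps) (simp_all add: gap_size_def del: upt_Suc)
  finally show ?thesis .
qed

text \<open>
  Applying \<open>\<pi>\<close> to the filtered list gives the values on \<open>as\<close> in increasing order, and a strictly
  sorted list is determined by its set.
\<close>

lemma filter_inverse_eq_iff:
  assumes \<pi>: "\<pi> permutes {1..n}" and as: "set as \<subseteq> {1..n}"
  shows "filter (\<lambda>x. x \<in> set as) (map (inv \<pi>) [1..<Suc n]) = as \<longleftrightarrow> sorted_wrt (<) (map \<pi> as)"
proof -
  let ?F = "filter (\<lambda>x. x \<in> set as) (map (inv \<pi>) [1..<Suc n])"
  have "map \<pi> ?F = filter (\<lambda>y. inv \<pi> y \<in> set as) [1..<Suc n]"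
    by (simp add: filter_map o_def permutes_inverses[OF \<pi>] del: upt_Suc)
  then have sorted: "sorted_wrt (<) (map \<pi> ?F)"
    by (simp add: sorted_wrt_filter del: upt_Suc)
  have "set ?F = set as \<inter> inv \<pi> ` {1..n}"
    by (auto simp del: upt_Suc)
  also have "\<dots> = set as"
    unfolding permutes_image[OF permutes_inv[OF \<pi>]] using as by blast
  finally have set: "set (map \<pi> ?F) = set (map \<pi> as)" by simp
  show ?thesis
  proof
    assume "?F = as"
    with sorted show "sorted_wrt (<) (map \<pi> as)" by simp
  next
    assume "sorted_wrt (<) (map \<pi> as)"
    with sorted set have "map \<pi> ?F = map \<pi> as"
      by (intro strict_sorted_equal)
    then show "?F = as"
      using permutes_inj[OF \<pi>] by (simp only: inj_map_eq_map)
  qed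
qed

lemma bij_betw_inverse_list:
  "bij_betw (\<lambda>\<pi>. map (inv \<pi>) [1..<Suc n]) {\<pi>. \<pi> permutes {1..n}} (permutations_of_set {1..n})"
proof -
  let ?f = "\<lambda>\<pi> :: nat \<Rightarrow> nat. map (inv \<pi>) [1..<Suc n]"
  have "inj_on ?f {\<pi>. \<pi> permutes {1..n}}"
  proof (rule inj_onI)
    fix \<pi> \<sigma> :: "nat \<Rightarrow> nat"
    assume \<pi>: "\<pi> \<in> {\<pi>. \<pi> permutes {1..n}}" and \<sigma>: "\<sigma> \<in> {\<pi>. \<pi> permutes {1..n}}" and eq: "?f \<pi> = ?f \<sigma>"
    have "inv \<pi> x = inv \<sigma> x" for x
    proof (cases "x \<in> {1..n}")
      case True
      with eq show ?thesis by (auto simp: map_eq_conv simp del: upt_Suc)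
    next
      case False
      with \<pi> \<sigma> show ?thesis by (metis mem_Collect_eq permutes_inv permutes_not_in)
    qed
    then have "inv \<pi> = inv \<sigma>" by blast
    with \<pi> \<sigma> show "\<pi> = \<sigma>" by (metis mem_Collect_eq permutes_inv_inv)
  qed
  moreover have "?f ` {\<pi>. \<pi> permutes {1..n}} \<subseteq> permutations_of_set {1..n}"
  proof (intro image_subsetI permutations_of_setI)
    fix \<pi> :: "nat \<Rightarrow> nat" assume "\<pi> \<in> {\<pi>. \<pi> permutes {1..n}}"
    then have "inv \<pi> permutes {1..n}" by (simp add: permutes_inv)
    then show "set (?f \<pi>) = {1..n}" "distinct (?f \<pi>)"
      using permutes_image[of "inv \<pi>" "{1..n}"]
      by (auto simp: distinct_map atLeastLessThanSuc_atLeastAtMost inj_on_subset[OF permutes_inj] simp del: upt_Suc)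
  qed
  moreover have "card {\<pi> :: nat \<Rightarrow> nat. \<pi> permutes {1..n}} = card (permutations_of_set {1..n})"
    by (simp add: card_permutations)
  ultimately show ?thesis
    by (simp add: bij_betw_def card_image card_subset_eq)
qed

text \<open>
  Inversion carries the permutations in question to the linear extensions of the two tuples. The factor
  after \<open>fact n\<close> is the probability that a uniformly random permutation increases along both.
\<close>

lemma card_increasing_on_pair:
  assumes "as \<in> index_tuples n k" "bs \<in> index_tuples n l"
  shows "real (card {\<pi>. \<pi> permutes {1..n} \<and> sorted_wrt (<) (map \<pi> as) \<and> sorted_wrt (<) (map \<pi> bs)})
    = fact n * (shuffle_count (gaps as bs) / fact (gap_size (gaps as bs)))"
proof -
  have as: "set as \<subseteq> {1..n}" "sorted_wrt (<) as" and bs: "set bs \<subseteq> {1..n}" "sorted_wrt (<) bs"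
    using assms by (auto simp: index_tuples_def)
  let ?f = "\<lambda>\<pi> :: nat \<Rightarrow> nat. map (inv \<pi>) [1..<Suc n]"
  let ?A = "{\<pi>. \<pi> permutes {1..n} \<and> sorted_wrt (<) (map \<pi> as) \<and> sorted_wrt (<) (map \<pi> bs)}"
  have "?A = {\<pi> \<in> {\<pi>. \<pi> permutes {1..n}}. sorted_wrt (<) (map \<pi> as) \<and> sorted_wrt (<) (map \<pi> bs)}"
    by simp
  moreover have "bij_betw ?f \<dots> (linear_extensions {1..n} as bs)"
    unfolding linear_extensions_def
    by (rule bij_betw_Collect[OF bij_betw_inverse_list])
       (use filter_inverse_eq_iff as(1) bs(1) in blast)
  ultimately have "bij_betw ?f ?A (linear_extensions {1..n} as bs)"
    by simp
  then have "card ?A = card (linear_extensions {1..n} as bs)"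
    by (rule bij_betw_same_card)
  moreover have "card (linear_extensions {1..n} as bs) * fact (gap_size (gaps as bs)) = fact n * shuffle_count (gaps as bs)"
    using card_linear_extensions[OF finite_atLeastAtMost as(1) bs(1) as(2) bs(2)] gap_size_gaps[OF as(2) bs(2)] by simp
  then have "real (card (linear_extensions {1..n} as bs)) * fact (gap_size (gaps as bs)) = fact n * real (shuffle_count (gaps as bs))"
    by (metis of_nat_fact of_nat_mult)
  ultimately show ?thesis by (simp add: field_simps)
qed

lemma expectation_random_perm:
  fixes f :: "(nat \<Rightarrow> nat) \<Rightarrow> real"
  shows "measure_pmf.expectation (random_perm n) f = (\<Sum>\<pi> | \<pi> permutes {1..n}. f \<pi>) / fact n"
  unfolding random_perm_def
  by (subst integral_pmf_of_set) (auto simp: finite_permutations card_permutations intro: exI[of _ id] permutes_id)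

lemma expectation_Z: "measure_pmf.expectation (random_perm n) (Z n k) = real (n choose k) * (1 / fact k)"
proof -
  let ?P = "{\<pi>. \<pi> permutes {1..n}}"
  have fin: "finite ?P" by (simp add: finite_permutations)
  have "(\<Sum>\<pi>\<in>?P. Z n k \<pi>) = (\<Sum>as\<in>index_tuples n k. \<Sum>\<pi>\<in>?P. of_bool (sorted_wrt (<) (map \<pi> as)))"
    unfolding Z_def by (rule sum.swap)
  also have "\<dots> = (\<Sum>as\<in>index_tuples n k. fact n * (1 / fact k))"
  proof (rule sum.cong[OF refl])
    fix as assume as: "as \<in> index_tuples n k"
    have "(\<Sum>\<pi>\<in>?P. of_bool (sorted_wrt (<) (map \<pi> as))) =
        real (card {\<pi>. \<pi> permutes {1..n} \<and> sorted_wrt (<) (map \<pi> as)})"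
      using fin by (simp add: sum_of_bool_eq Int_def)
    also have "\<dots> = fact n * (1 / fact k)"
      using card_increasing_on_pair[OF as, of "[]" 0] as
      by (simp add: gaps_Nil_right gap_size_def index_tuples_def)
    finally show "(\<Sum>\<pi>\<in>?P. of_bool (sorted_wrt (<) (map \<pi> as))) = (fact n * (1 / fact k) :: real)" .
  qed
  finally show ?thesis
    by (simp add: expectation_random_perm card_index_tuples)
qed

text \<open>
  Each square pairs an arrangement of positions with an arrangement of values in the same gaps. The
  sum therefore counts the pairs of sets of size \<open>t + m\<close> that cover \<open>{1..t + 2 m}\<close> and share \<open>t\<close>
  elements, each together with an order of the values that increases on both sets.
\<close>

definition overlap_count :: "nat \<Rightarrow> nat \<Rightarrow> real" where
  "overlap_count t m = (\<Sum>g\<in>gap_lists (Suc t) m m. (real (shuffle_count g))\<^sup>2)"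

text \<open>
  Grouping the pairs of index tuples by their gap list makes every summand constant on its group.
  The group contributes one factor \<open>shuffle_count\<close> for the positions and one for the values.
\<close>

lemma expectation_Z_square:
  "measure_pmf.expectation (random_perm n) (\<lambda>\<pi>. (Z n k \<pi>)\<^sup>2) =
    (\<Sum>t\<le>k. real (n choose (2 * k - t)) / fact (2 * k - t) * overlap_count t (k - t))"
proof -
  let ?P = "{\<pi>. \<pi> permutes {1..n}}" and ?I = "index_tuples n k"
  define S where "S = (\<Union>t\<le>k. gap_lists (Suc t) (k - t) (k - t))"
  have fin: "finite ?P" by (simp add: finite_permutations)
  have "(\<Sum>\<pi>\<in>?P. (Z n k \<pi>)\<^sup>2) =
      (\<Sum>\<pi>\<in>?P. \<Sum>p\<in>?I \<times> ?I. of_bool (sorted_wrt (<) (map \<pi> (fst p)) \<and> sorted_wrt (<) (map \<pi> (snd p))))"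
    unfolding Z_def power2_eq_square sum_product sum.cartesian_product of_bool_conj case_prod_unfold ..
  also have "\<dots> = (\<Sum>p\<in>?I \<times> ?I. \<Sum>\<pi>\<in>?P. of_bool (sorted_wrt (<) (map \<pi> (fst p)) \<and> sorted_wrt (<) (map \<pi> (snd p))))"
    by (rule sum.swap)
  also have "\<dots> = (\<Sum>p\<in>?I \<times> ?I. fact n * (shuffle_count (gaps (fst p) (snd p)) / fact (gap_size (gaps (fst p) (snd p)))))"
  proof (rule sum.cong[OF refl])
    fix p assume p: "p \<in> ?I \<times> ?I"
    have "(\<Sum>\<pi>\<in>?P. of_bool (sorted_wrt (<) (map \<pi> (fst p)) \<and> sorted_wrt (<) (map \<pi> (snd p)))) =
        real (card {\<pi>. \<pi> permutes {1..n} \<and> sorted_wrt (<) (map \<pi> (fst p)) \<and> sorted_wrt (<) (map \<pi> (snd p))})"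
      using fin by (simp add: sum_of_bool_eq Int_def)
    also have "\<dots> = fact n * (shuffle_count (gaps (fst p) (snd p)) / fact (gap_size (gaps (fst p) (snd p))))"
      using p by (intro card_increasing_on_pair) auto
    finally show "(\<Sum>\<pi>\<in>?P. of_bool (sorted_wrt (<) (map \<pi> (fst p)) \<and> sorted_wrt (<) (map \<pi> (snd p)))) =
      fact n * (shuffle_count (gaps (fst p) (snd p)) / fact (gap_size (gaps (fst p) (snd p))))" .
  qed
  also have "\<dots> = (\<Sum>g\<in>S. \<Sum>p | p \<in> ?I \<times> ?I \<and> gaps (fst p) (snd p) = g.
      fact n * (shuffle_count (gaps (fst p) (snd p)) / fact (gap_size (gaps (fst p) (snd p)))))"
  proof (rule sum.group[symmetric])
    show "(\<lambda>p. gaps (fst p) (snd p)) ` (?I \<times> ?I) \<subseteq> S"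
    proof (rule image_subsetI)
      fix p assume "p \<in> ?I \<times> ?I"
      then have len: "length (fst p) = k" "length (snd p) = k"
        by (auto simp: index_tuples_def)
      let ?g = "gaps (fst p) (snd p)"
      obtain t where t: "length ?g = Suc t"
        using gaps_neq_Nil[of "fst p" "snd p"] by (cases ?g) auto
      then have "t \<le> k" "?g \<in> gap_lists (Suc t) (k - t) (k - t)"
        using sum_fst_gaps[of "fst p" "snd p"] sum_snd_gaps[of "fst p" "snd p"] len
        by (auto simp: gap_lists_def)
      then show "?g \<in> S" unfolding S_def by blast
    qed
  qed (simp_all add: S_def)
  also have "\<dots> = (\<Sum>g\<in>S. fact n * (real (n choose gap_size g) / fact (gap_size g) * (real (shuffle_count g))\<^sup>2))"
  proof (rule sum.cong[OF refl])
    fix g assume "g \<in> S"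
    then obtain t where g: "t \<le> k" "length g = Suc t" "sum_list (map fst g) = k - t" "sum_list (map snd g) = k - t"
      by (auto simp: S_def gap_lists_def)
    have len: "length as = k \<and> length bs = k" if "gaps as bs = g" for as bs :: "nat list"
      using that sum_fst_gaps[of as bs] sum_snd_gaps[of as bs] g by simp
    have "(as, bs) \<in> ?I \<times> ?I \<and> gaps as bs = g \<longleftrightarrow> (as, bs) \<in> pairs_with_gaps [1..<Suc n] g" for as bs
      using len[of as bs] unfolding pairs_with_gaps_def index_tuples_eq_subseq by blast
    then have "p \<in> ?I \<times> ?I \<and> gaps (fst p) (snd p) = g \<longleftrightarrow> p \<in> pairs_with_gaps [1..<Suc n] g" for p
      by (metis prod.collapse)
    then have eq: "{p. p \<in> ?I \<times> ?I \<and> gaps (fst p) (snd p) = g} = pairs_with_gaps [1..<Suc n] g"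
      by blast
    have gaps_eq: "gaps (fst p) (snd p) = g" if "p \<in> pairs_with_gaps [1..<Suc n] g" for p
      using that by (auto simp: pairs_with_gaps_def)
    have card: "card (pairs_with_gaps [1..<Suc n] g) = (n choose gap_size g) * shuffle_count g"
      using g by (subst card_pairs_with_gaps) (auto simp del: upt_Suc)
    have "(\<Sum>p\<in>pairs_with_gaps [1..<Suc n] g.
        fact n * (shuffle_count (gaps (fst p) (snd p)) / fact (gap_size (gaps (fst p) (snd p))))) =
      (\<Sum>p\<in>pairs_with_gaps [1..<Suc n] g. fact n * (real (shuffle_count g) / fact (gap_size g)))"
      by (intro sum.cong refl) (simp only: gaps_eq)
    also have "\<dots> = fact n * (real (n choose gap_size g) / fact (gap_size g) * (real (shuffle_count g))\<^sup>2)"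
      by (simp add: card power2_eq_square del: upt_Suc One_nat_def)
    finally show "(\<Sum>p | p \<in> ?I \<times> ?I \<and> gaps (fst p) (snd p) = g.
        fact n * (shuffle_count (gaps (fst p) (snd p)) / fact (gap_size (gaps (fst p) (snd p))))) =
      fact n * (real (n choose gap_size g) / fact (gap_size g) * (real (shuffle_count g))\<^sup>2)"
      unfolding eq .
  qed
  also have "\<dots> = fact n * (\<Sum>g\<in>S. real (n choose gap_size g) / fact (gap_size g) * (real (shuffle_count g))\<^sup>2)"
    by (simp add: sum_distrib_left)
  also have "(\<Sum>g\<in>S. real (n choose gap_size g) / fact (gap_size g) * (real (shuffle_count g))\<^sup>2) =
      (\<Sum>t\<le>k. \<Sum>g\<in>gap_lists (Suc t) (k - t) (k - t). real (n choose gap_size g) / fact (gap_size g) * (real (shuffle_count g))\<^sup>2)"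
  proof -
    have "gap_lists (Suc t) (k - t) (k - t) \<inter> gap_lists (Suc t') (k - t') (k - t') = {}" if "t \<noteq> t'" for t t'
      using that by (auto simp: gap_lists_def)
    then show ?thesis
      unfolding S_def by (intro sum.UNION_disjoint) simp_all
  qed
  also have "\<dots> = (\<Sum>t\<le>k. real (n choose (2 * k - t)) / fact (2 * k - t) * overlap_count t (k - t))"
  proof (rule sum.cong[OF refl])
    fix t assume t: "t \<in> {..k}"
    have "gap_size g = 2 * k - t" if "g \<in> gap_lists (Suc t) (k - t) (k - t)" for g
      using that t by (auto simp: gap_lists_def gap_size_def)
    then show "(\<Sum>g\<in>gap_lists (Suc t) (k - t) (k - t). real (n choose gap_size g) / fact (gap_size g) * (real (shuffle_count g))\<^sup>2)
        = real (n choose (2 * k - t)) / fact (2 * k - t) * overlap_count t (k - t)"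
      by (simp add: overlap_count_def sum_distrib_left)
  qed
  finally show ?thesis
    by (simp add: expectation_random_perm)
qed

section \<open>The generating function of squared shuffle counts\<close>

unbundle no vec_syntax
unbundle fps_syntax

text \<open>
  Bivariate series are series in \<open>y\<close> whose coefficients are series in \<open>x\<close>. This one is
  \<open>1 - x - y\<close>, and \<open>f $ j $ i\<close> is the coefficient of \<open>x\<^sup>i y\<^sup>j\<close>.
\<close>

definition den :: "real fps fps" where
  "den = 1 - fps_const fps_X - fps_X"

text \<open>
  The explicit coefficients of the power \<open>q + 1\<close> of the inverse of \<open>1 - x - y\<close>.
\<close>

definition den_inverse :: "nat \<Rightarrow> real fps fps" where
  "den_inverse q = Abs_fps (\<lambda>j. Abs_fps (\<lambda>i. real (((q + i + j) choose (i + j)) * ((i + j) choose i))))"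

lemma den_inverse_nth: "den_inverse q $ j $ i = real (((q + i + j) choose (i + j)) * ((i + j) choose i))"
  by (simp add: den_inverse_def)

lemma den_mult_nth:
  "(den * f) $ j $ i = f $ j $ i - (if i = 0 then 0 else f $ j $ (i - 1)) - (if j = 0 then 0 else f $ (j - 1) $ i)"
proof -
  have "den * f = f - fps_const fps_X * f - fps_X * f"
    by (simp add: den_def algebra_simps)
  then show ?thesis by (simp add: fps_X_mult_nth)
qed

lemma den_den_inverse_0: "den * den_inverse 0 = 1"
proof (rule fps_ext, rule fps_ext)
  fix j i
  show "(den * den_inverse 0) $ j $ i = (1 :: real fps fps) $ j $ i"
    by (cases i; cases j) (simp_all add: den_mult_nth den_inverse_nth del: fps_mult_nth_0)
qed

text \<open>
  Two applications of the rule of Pascal, to each of the two binomial coefficients.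
\<close>

lemma den_den_inverse_Suc: "den * den_inverse (Suc q) = den_inverse q"
proof (rule fps_ext, rule fps_ext)
  fix j i
  show "(den * den_inverse (Suc q)) $ j $ i = den_inverse q $ j $ i"
  proof (cases "i + j")
    case 0
    then show ?thesis by (simp add: den_mult_nth den_inverse_nth del: fps_mult_nth_0)
  next
    case (Suc n)
    have up: "(Suc q + Suc n) choose Suc n = ((Suc q + n) choose n) + ((q + Suc n) choose Suc n)"
      by simp
    have low: "(Suc n choose i) = (if i = 0 then 0 else n choose (i - 1)) + (if j = 0 then 0 else n choose i)"
      using Suc by (cases i; cases j) simp_all
    \<comment> \<open>with the sum of the indices abbreviated, both binomial coefficients can be expanded\<close>
    have entry: "den_inverse (Suc q) $ j' $ i' = real (((Suc q + m) choose m) * (m choose i'))"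
      if "i' + j' = m" for i' j' m
      using that by (auto simp: den_inverse_nth add.assoc)
    have "i \<noteq> 0 \<Longrightarrow> i - 1 + j = n" "j \<noteq> 0 \<Longrightarrow> i + (j - 1) = n"
      using Suc by auto
    then have "(den * den_inverse (Suc q)) $ j $ i =
      real (((Suc q + Suc n) choose Suc n) * (Suc n choose i))
      - real (((Suc q + n) choose n) * (if i = 0 then 0 else n choose (i - 1)))
      - real (((Suc q + n) choose n) * (if j = 0 then 0 else n choose i))"
      by (auto simp: den_mult_nth entry[OF Suc] entry simp del: fps_mult_nth_0 binomial_Suc_Suc mult_Suc mult_Suc_right)
    also have "\<dots> = real (((Suc q + Suc n) choose Suc n) * (Suc n choose i))
      - real (((Suc q + n) choose n) * (Suc n choose i))"
      unfolding low by (simp only: of_nat_add of_nat_mult distrib_left diff_diff_add)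
    also have "\<dots> = real (((q + Suc n) choose Suc n) * (Suc n choose i))"
      unfolding up by (simp only: of_nat_add of_nat_mult distrib_right)
    finally show ?thesis
      using Suc by (simp add: den_inverse_nth add.assoc)
  qed
qed

lemma den_inverse_eq_power: "den_inverse q = den_inverse 0 ^ Suc q"
proof (induction q)
  case 0
  show ?case by simp
next
  case (Suc q)
  have "den_inverse (Suc q) = den_inverse 0 * den * den_inverse (Suc q)"
    using den_den_inverse_0 by (simp add: mult.commute)
  also have "\<dots> = den_inverse 0 * den_inverse q"
    using den_den_inverse_Suc[of q] by (simp only: mult.assoc)
  finally show ?case using Suc by simp
qed

text \<open>
  The series of \<open>(1 - z)\<close> to the power \<open>- c\<close>, with real coefficients embedded as constants so that
  bivariate series can be substituted for \<open>z\<close>.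
\<close>

definition neg_binomial_series :: "real \<Rightarrow> real fps fps" where
  "neg_binomial_series c = Abs_fps (\<lambda>s. fps_const ((real s + c - 1) gchoose s))"

lemma neg_binomial_series_nth: "neg_binomial_series c $ s = fps_const ((-1) ^ s * ((- c) gchoose s))"
  by (simp add: neg_binomial_series_def gbinomial_minus add.commute)

text \<open>
  The exponents add up by the Vandermonde convolution.
\<close>

lemma neg_binomial_series_add:
  "neg_binomial_series (c + d) = neg_binomial_series c * neg_binomial_series d"
proof (rule fps_ext)
  fix n
  have "(neg_binomial_series c * neg_binomial_series d) $ n =
    (\<Sum>i=0..n. fps_const ((-1) ^ n * (((- c) gchoose i) * ((- d) gchoose (n - i)))))"
    unfolding fps_mult_nth
  proof (rule sum.cong[OF refl])
    fix i assume "i \<in> {0..n}"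
    then have "(-1::real) ^ n = (-1) ^ i * (-1) ^ (n - i)"
      by (simp flip: power_add)
    then show "neg_binomial_series c $ i * neg_binomial_series d $ (n - i) =
        fps_const ((-1) ^ n * (((- c) gchoose i) * ((- d) gchoose (n - i))))"
      by (simp add: neg_binomial_series_nth)
  qed
  also have "\<dots> = fps_const ((-1) ^ n * (\<Sum>i=0..n. ((- c) gchoose i) * ((- d) gchoose (n - i))))"
    by (rule fps_ext) (simp add: fps_sum_nth sum_distrib_left)
  also have "(\<Sum>i=0..n. ((- c) gchoose i) * ((- d) gchoose (n - i))) = (- c + - d) gchoose n"
    by (rule gbinomial_Vandermonde)
  also have "fps_const ((-1) ^ n * ((- c + - d) gchoose n)) = neg_binomial_series (c + d) $ n"
    by (simp add: neg_binomial_series_nth)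
  finally show "neg_binomial_series (c + d) $ n = (neg_binomial_series c * neg_binomial_series d) $ n" ..
qed

lemma neg_binomial_series_0: "neg_binomial_series 0 = 1"
proof (rule fps_ext)
  fix n show "neg_binomial_series 0 $ n = 1 $ n"
    by (cases n) (simp_all add: neg_binomial_series_nth)
qed

lemma mult_compose_nth:
  fixes A K u :: "'a::comm_ring_1 fps"
  assumes "u $ 0 = 0"
  shows "(A * (K oo u)) $ n = (\<Sum>s\<le>n. K $ s * (A * u ^ s) $ n)"
proof -
  have ext: "(K oo u) $ j = (\<Sum>s\<le>n. K $ s * (u ^ s) $ j)" if "j \<le> n" for j
    unfolding fps_compose_nth
    by (rule sum.mono_neutral_left)
       (use that assms startsby_zero_power_prefix[of u] in auto)
  have "(A * (K oo u)) $ n = (\<Sum>i=0..n. A $ i * (\<Sum>s\<le>n. K $ s * (u ^ s) $ (n - i)))"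
    unfolding fps_mult_nth by (intro sum.cong) (simp_all add: ext)
  also have "\<dots> = (\<Sum>i=0..n. \<Sum>s\<le>n. K $ s * (A $ i * (u ^ s) $ (n - i)))"
    by (simp add: sum_distrib_left mult_ac)
  also have "\<dots> = (\<Sum>s\<le>n. K $ s * (A * u ^ s) $ n)"
    by (subst sum.swap) (simp add: fps_mult_nth sum_distrib_left)
  finally show ?thesis .
qed

text \<open>
  The series \<open>4xy / (1 - x - y)\<^sup>2\<close>.
\<close>

definition radical_part :: "real fps fps" where
  "radical_part = fps_const (4 * fps_X) * fps_X * den_inverse 0 ^ 2"

text \<open>
  The series \<open>((1 - x - y)\<^sup>2 - 4xy)\<close> to the power \<open>- r / 2\<close>, written so that the factor
  \<open>(1 - x - y)\<^sup>2\<close> is taken out of the radical and the half-integral power acts on a series with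
  constant term 1.
\<close>

definition gap_series :: "nat \<Rightarrow> real fps fps" where
  "gap_series r = den_inverse 0 ^ r * (neg_binomial_series (real r / 2) oo radical_part)"

lemma radical_part_0: "radical_part $ 0 = 0"
  by (simp add: radical_part_def fps_mult_nth)

lemma gap_series_add: "gap_series (r + r') = gap_series r * gap_series r'"
  by (simp add: gap_series_def add_divide_distrib neg_binomial_series_add power_add
      fps_compose_mult_distrib[OF radical_part_0] mult_ac)

lemma numeral_fps_const: "(4 * f :: real fps) $ n = 4 * f $ n"
  by (metis fps_mult_left_const_nth fps_numeral_fps_const)

lemma radical_part_power: "radical_part ^ s = fps_const (fps_const (4 ^ s) * fps_X ^ s) * (fps_X ^ s * den_inverse 0 ^ (2 * s))"
  by (simp add: radical_part_def power_mult_distrib power_mult numeral_fps_const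
      mult.assoc fps_const_power fps_numeral_fps_const del: fps_const_mult)

text \<open>
  The power \<open>s\<close> of \<open>radical_part\<close> shifts both indices by \<open>s\<close> and raises the exponent of
  \<open>1 / (1 - x - y)\<close> by \<open>2 s\<close>, so each summand is a single explicit coefficient.
\<close>

lemma gap_series_nth:
  "gap_series (Suc t) $ b $ a = (\<Sum>s\<le>b. ((real s + (real t + 1) / 2 - 1) gchoose s) *
     (if s \<le> a then 4 ^ s * real (((t + a + b) choose (a + b - 2 * s)) * ((a + b - 2 * s) choose (a - s))) else 0))"
proof -
  have "gap_series (Suc t) $ b $ a = (\<Sum>s\<le>b. neg_binomial_series (real (Suc t) / 2) $ s * (den_inverse 0 ^ Suc t * radical_part ^ s) $ b) $ a"
    unfolding gap_series_def by (subst mult_compose_nth[OF radical_part_0]) simp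
  also have "\<dots> = (\<Sum>s\<le>b. ((real s + (real t + 1) / 2 - 1) gchoose s) * (den_inverse 0 ^ Suc t * radical_part ^ s) $ b $ a)"
    by (simp add: fps_sum_nth neg_binomial_series_def add_ac)
  also have "\<dots> = (\<Sum>s\<le>b. ((real s + (real t + 1) / 2 - 1) gchoose s) *
     (if s \<le> a then 4 ^ s * real (((t + a + b) choose (a + b - 2 * s)) * ((a + b - 2 * s) choose (a - s))) else 0))"
  proof (rule sum.cong[OF refl])
    fix s assume s: "s \<in> {..b}"
    have "den_inverse 0 ^ Suc t * radical_part ^ s = fps_const (fps_const (4 ^ s) * fps_X ^ s) * (fps_X ^ s * den_inverse (t + 2 * s))"
      unfolding den_inverse_eq_power[of "t + 2 * s"] by (simp add: radical_part_power power_add mult_ac)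
    then have "(den_inverse 0 ^ Suc t * radical_part ^ s) $ b $ a = 4 ^ s * (if s \<le> a then den_inverse (t + 2 * s) $ (b - s) $ (a - s) else 0)"
      using s by (simp add: fps_X_power_mult_nth mult.assoc)
    also have "\<dots> = (if s \<le> a then 4 ^ s * real (((t + a + b) choose (a + b - 2 * s)) * ((a + b - 2 * s) choose (a - s))) else 0)"
    proof (cases "s \<le> a")
      case True
      then have "a - s + (b - s) = a + b - 2 * s" "t + 2 * s + (a - s) + (b - s) = t + a + b"
        using s by auto
      then show ?thesis by (simp only: den_inverse_nth True if_True)
    qed simp
    finally show "((real s + (real t + 1) / 2 - 1) gchoose s) * (den_inverse 0 ^ Suc t * radical_part ^ s) $ b $ a =
      ((real s + (real t + 1) / 2 - 1) gchoose s) *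
     (if s \<le> a then 4 ^ s * real (((t + a + b) choose (a + b - 2 * s)) * ((a + b - 2 * s) choose (a - s))) else 0)"
      by (simp only:)
  qed
  finally show ?thesis .
qed

lemma central_binomial_gchoose: "4 ^ p * ((real p - 1 / 2) gchoose p) = real ((2 * p) choose p)"
proof -
  have "(real p - 1 / 2) gchoose p = pochhammer (1 / 2) p / fact p"
    by (simp add: gbinomial_pochhammer')
  moreover have "fact (2 * p) = (4 ^ p * pochhammer (1 / 2) p * fact p :: real)"
    using fact_double[of p, where 'a = real] by (simp add: power_mult)
  moreover have "real ((2 * p) choose p) = fact (2 * p) / (fact p * fact p)"
    by (simp add: binomial_fact)
  ultimately show ?thesis by simp
qed

text \<open>
  Both sides are the multinomial coefficient \<open>(a + b)! / (s!\<^sup>2 (a - s)! (b - s)!)\<close>.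
\<close>

lemma central_times_choose:
  assumes "s \<le> a" "s \<le> b"
  shows "((2 * s) choose s) * (((a + b) choose (a + b - 2 * s)) * ((a + b - 2 * s) choose (a - s)))
    = ((a + b) choose a) * ((a choose s) * (b choose (b - s)))"
proof -
  have "a + b - 2 * s - (a - s) = b - s" "a + b - (a + b - 2 * s) = 2 * s" using assms by auto
  then have "real (((2 * s) choose s) * (((a + b) choose (a + b - 2 * s)) * ((a + b - 2 * s) choose (a - s))))
    = real (((a + b) choose a) * ((a choose s) * (b choose (b - s))))"
    using assms by (simp add: binomial_fact)
  then show ?thesis by (simp only: of_nat_eq_iff)
qed

text \<open>
  For \<open>r = 1\<close> the binomial coefficients of the half-integral power are central ones, and the sum over
  \<open>s\<close> collapses by the Vandermonde identity.
\<close>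

lemma gap_series_1_nth: "gap_series 1 $ b $ a = (real ((a + b) choose a))\<^sup>2"
proof -
  have "gap_series 1 $ b $ a = (\<Sum>s\<le>b. real (((a + b) choose a) * ((a choose s) * (b choose (b - s)))))"
  proof (simp only: One_nat_def gap_series_nth, rule sum.cong[OF refl])
    fix s assume "s \<in> {..b}"
    then have s: "s \<le> b" by simp
    show "((real s + (real 0 + 1) / 2 - 1) gchoose s) *
       (if s \<le> a then 4 ^ s * real (((0 + a + b) choose (a + b - 2 * s)) * ((a + b - 2 * s) choose (a - s))) else 0) =
       real (((a + b) choose a) * ((a choose s) * (b choose (b - s))))"
    proof (cases "s \<le> a")
      case True
      have "real s + (real 0 + 1) / 2 - 1 = real s - 1 / 2" by (simp add: field_simps)
      then show ?thesis
        using arg_cong[OF central_times_choose[OF True s], of real] True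
        unfolding of_nat_mult central_binomial_gchoose[of s, symmetric]
        by (simp add: mult_ac)
    qed simp
  qed
  also have "\<dots> = real (((a + b) choose a) * (\<Sum>s\<le>b. (a choose s) * (b choose (b - s))))"
    by (simp add: sum_distrib_left)
  also have "(\<Sum>s\<le>b. (a choose s) * (b choose (b - s))) = (a + b) choose b"
    by (rule vandermonde)
  also have "(a + b) choose b = (a + b) choose a"
    using binomial_symmetric[of b "a + b"] by simp
  finally show ?thesis by (simp add: power2_eq_square)
qed

text \<open>
  Splitting off the first gap is multiplication by \<open>gap_series 1\<close>.
\<close>

lemma sum_gap_lists_eq_gap_series:
  "(\<Sum>g\<in>gap_lists r a b. (real (shuffle_count g))\<^sup>2) = gap_series r $ b $ a"
proof (induction r arbitrary: a b)
  case 0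
  then show ?case by (simp add: gap_lists_0 gap_series_def neg_binomial_series_0)
next
  case (Suc r)
  have "(\<Sum>g\<in>gap_lists (Suc r) a b. (real (shuffle_count g))\<^sup>2) =
      (\<Sum>(i, j)\<in>{..a} \<times> {..b}. \<Sum>g\<in>Cons (i, j) ` gap_lists r (a - i) (b - j). (real (shuffle_count g))\<^sup>2)"
    unfolding gap_lists_Suc
    by (subst sum.UNION_disjoint) (auto intro!: sum.cong)
  also have "\<dots> = (\<Sum>(i, j)\<in>{..a} \<times> {..b}. gap_series 1 $ j $ i * gap_series r $ (b - j) $ (a - i))"
    by (intro sum.cong refl)
       (auto simp: sum.reindex power_mult_distrib gap_series_1_nth[unfolded One_nat_def] gap_series_1_nth Suc.IH[symmetric] sum_distrib_left)
  also have "\<dots> = (\<Sum>j\<le>b. \<Sum>i\<le>a. gap_series 1 $ j $ i * gap_series r $ (b - j) $ (a - i))"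
    by (subst sum.cartesian_product[symmetric]) (rule sum.swap)
  also have "\<dots> = (gap_series 1 * gap_series r) $ b $ a"
    by (simp add: fps_mult_nth fps_sum_nth atLeast0AtMost)
  also have "gap_series 1 * gap_series r = gap_series (Suc r)"
    using gap_series_add[of 1 r] by simp
  finally show ?case .
qed

lemma sum_diagonal_gap_lists:
  "(\<Sum>g\<in>gap_lists (Suc t) m m. (real (shuffle_count g))\<^sup>2) =
    (\<Sum>s\<le>m. ((real s + (real t + 1) / 2 - 1) gchoose s) * 4 ^ s *
       real ((t + 2 * m) choose (2 * m - 2 * s)) * real ((2 * m - 2 * s) choose (m - s)))"
  unfolding sum_gap_lists_eq_gap_series gap_series_nth
  by (intro sum.cong) (auto simp: mult_2 add.assoc mult.assoc)

unbundle no fps_syntax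
unbundle vec_syntax

section \<open>The closed form of the second moment\<close>

lemma overlap_count_eq:
  "overlap_count t m = (\<Sum>s\<le>m. ((real s + (real t + 1) / 2 - 1) gchoose s) * 4 ^ s *
       real ((t + 2 * m) choose (2 * m - 2 * s)) * real ((2 * m - 2 * s) choose (m - s)))"
  unfolding overlap_count_def by (rule sum_diagonal_gap_lists)

text \<open>
  The power \<open>4 ^ (k - t)\<close> has two sources: \<open>4 ^ s\<close> comes from expanding \<open>gap_series\<close>, and the rest turns
  the central binomial coefficient of order \<open>k - t - s\<close> into one with a half-integral upper index.
\<close>

lemma second_moment_formula:
  "(\<Sum>t\<le>k. real (n choose (2 * k - t)) / fact (2 * k - t) * overlap_count t (k - t)) =
   (\<Sum>(t, s)\<in>{(t, s). t + s \<le> k}.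
         4 ^ (k - t) / fact (2 * k - t) * real (n choose (2 * k - t))
         * ((real k - real t - real s - 1 / 2) gchoose (k - t - s))
         * ((real s + (real t + 1) / 2 - 1) gchoose s)
         * real ((2 * k - t) choose (2 * k - 2 * t - 2 * s)))"
proof -
  have set: "{(t, s). t + s \<le> k} = Sigma {..k} (\<lambda>t. {..k - t})" by auto
  have "(\<Sum>t\<le>k. real (n choose (2 * k - t)) / fact (2 * k - t) * overlap_count t (k - t)) =
    (\<Sum>t\<le>k. \<Sum>s\<le>k - t. 4 ^ (k - t) / fact (2 * k - t) * real (n choose (2 * k - t))
         * ((real k - real t - real s - 1 / 2) gchoose (k - t - s))
         * ((real s + (real t + 1) / 2 - 1) gchoose s)
         * real ((2 * k - t) choose (2 * k - 2 * t - 2 * s)))"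
  proof (rule sum.cong[OF refl])
    fix t assume t: "t \<in> {..k}"
    have "real (n choose (2 * k - t)) / fact (2 * k - t) * overlap_count t (k - t) =
      (\<Sum>s\<le>k - t. real (n choose (2 * k - t)) / fact (2 * k - t) *
         (((real s + (real t + 1) / 2 - 1) gchoose s) * 4 ^ s *
       real ((t + 2 * (k - t)) choose (2 * (k - t) - 2 * s)) * real ((2 * (k - t) - 2 * s) choose (k - t - s))))"
      unfolding overlap_count_eq by (rule sum_distrib_left)
    also have "\<dots> = (\<Sum>s\<le>k - t. 4 ^ (k - t) / fact (2 * k - t) * real (n choose (2 * k - t))
         * ((real k - real t - real s - 1 / 2) gchoose (k - t - s))
         * ((real s + (real t + 1) / 2 - 1) gchoose s)
         * real ((2 * k - t) choose (2 * k - 2 * t - 2 * s)))"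
    proof (rule sum.cong[OF refl])
      fix s assume s: "s \<in> {..k - t}"
      define p where "p = k - t - s"
      have idx: "t + 2 * (k - t) = 2 * k - t" "2 * (k - t) - 2 * s = 2 * p" "2 * k - 2 * t - 2 * s = 2 * p"
        "real k - real t - real s = real p" "(4::real) ^ (k - t) = 4 ^ s * 4 ^ p"
        using s t by (auto simp: p_def simp flip: power_add)
      show "real (n choose (2 * k - t)) / fact (2 * k - t) *
         (((real s + (real t + 1) / 2 - 1) gchoose s) * 4 ^ s *
       real ((t + 2 * (k - t)) choose (2 * (k - t) - 2 * s)) * real ((2 * (k - t) - 2 * s) choose (k - t - s))) =
        4 ^ (k - t) / fact (2 * k - t) * real (n choose (2 * k - t))
         * ((real k - real t - real s - 1 / 2) gchoose (k - t - s))
         * ((real s + (real t + 1) / 2 - 1) gchoose s)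
         * real ((2 * k - t) choose (2 * k - 2 * t - 2 * s))"
        unfolding idx p_def[symmetric] central_binomial_gchoose[symmetric]
        by simp
    qed
    finally show "real (n choose (2 * k - t)) / fact (2 * k - t) * overlap_count t (k - t) =
      (\<Sum>s\<le>k - t. 4 ^ (k - t) / fact (2 * k - t) * real (n choose (2 * k - t))
         * ((real k - real t - real s - 1 / 2) gchoose (k - t - s))
         * ((real s + (real t + 1) / 2 - 1) gchoose s)
         * real ((2 * k - t) choose (2 * k - 2 * t - 2 * s)))" .
  qed
  then show ?thesis
    unfolding set by (subst sum.Sigma[symmetric]) simp_all
qed

section \<open>The terms with at most one common index\<close>

text \<open>
  Compare the middle coefficients of \<open>(1 + x)\<^sup>2\<^sup>n = ((1 + x\<^sup>2) + 2x)\<^sup>n\<close> for \<open>n = 2m + 1\<close>: expanding the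
  right side, only even powers \<open>(1 + x\<^sup>2)\<^sup>2\<^sup>p\<close> have a middle coefficient.
\<close>

lemma sum_even_choose_eq_central_binomial:
  "(\<Sum>p\<le>m. 2 ^ (2 * m + 1 - 2 * p) * real ((2 * m + 1) choose (2 * p)) * real ((2 * p) choose p))
    = real ((4 * m + 2) choose (2 * m + 1))"
proof -
  let ?n = "2 * m + 1" and ?X = "fps_X :: real fps"
  have sq: "fps_nth ((1 + ?X ^ 2) ^ j) i = (\<Sum>p\<le>j. if i = 2 * p then real (j choose p) else 0)" for i j
  proof -
    have "(1 + ?X ^ 2) ^ j = (\<Sum>p\<le>j. of_nat (j choose p) * ?X ^ (2 * p))"
      using binomial_ring[of "?X ^ 2" 1 j] by (simp add: add.commute power_mult)
    then show ?thesis
      by (auto simp: fps_sum_nth fps_of_nat[symmetric] intro!: sum.cong)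
  qed
  have "fps_nth ((1 + ?X) ^ N) i = real (N choose i)" for N i
    by (simp add: fps_binomial_of_nat[symmetric] binomial_gbinomial)
  moreover have "4 * m + 2 = 2 * ?n" by simp
  ultimately have "real ((4 * m + 2) choose ?n) = fps_nth ((1 + ?X) ^ (2 * ?n)) ?n"
    by (simp only:)
  also have "(1 + ?X) ^ (2 * ?n) = ((1 + ?X ^ 2) + fps_const 2 * ?X) ^ ?n"
  proof -
    have "(1 + ?X) ^ 2 = (1 + ?X ^ 2) + 2 * ?X"
      by (simp add: power2_eq_square algebra_simps)
    then have "(1 + ?X) ^ 2 = (1 + ?X ^ 2) + fps_const 2 * ?X"
      by (simp only: fps_numeral_fps_const)
    then show ?thesis by (simp only: power_mult)
  qed
  also have "\<dots> = (\<Sum>j\<le>?n. of_nat (?n choose j) * (1 + ?X ^ 2) ^ j * (fps_const 2 * ?X) ^ (?n - j))"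
    by (rule binomial_ring)
  also have "\<dots> = (\<Sum>j\<le>?n. fps_const (real (?n choose j) * 2 ^ (?n - j)) * (?X ^ (?n - j) * (1 + ?X ^ 2) ^ j))"
  proof (intro sum.cong refl)
    fix j
    have "fps_const (real (?n choose j) * 2 ^ (?n - j)) = of_nat (?n choose j) * fps_const 2 ^ (?n - j)"
      by (simp only: fps_of_nat fps_const_power fps_const_mult[symmetric])
    then show "of_nat (?n choose j) * (1 + ?X ^ 2) ^ j * (fps_const 2 * ?X) ^ (?n - j) =
        fps_const (real (?n choose j) * 2 ^ (?n - j)) * (?X ^ (?n - j) * (1 + ?X ^ 2) ^ j)"
      by (simp only: power_mult_distrib mult_ac)
  qed
  also have "fps_nth \<dots> ?n = (\<Sum>j\<le>?n. real (?n choose j) * 2 ^ (?n - j) * fps_nth ((1 + ?X ^ 2) ^ j) j)"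
    unfolding fps_sum_nth by (intro sum.cong) (auto simp: fps_X_power_mult_nth)
  also have "\<dots> = (\<Sum>j\<in>(\<lambda>p. 2 * p) ` {..m}. real (?n choose j) * 2 ^ (?n - j) * fps_nth ((1 + ?X ^ 2) ^ j) j)"
  proof (rule sum.mono_neutral_right)
    show "\<forall>j\<in>{..?n} - (\<lambda>p. 2 * p) ` {..m}. real (?n choose j) * 2 ^ (?n - j) * fps_nth ((1 + ?X ^ 2) ^ j) j = 0"
    proof
      fix j assume j: "j \<in> {..?n} - (\<lambda>p. 2 * p) ` {..m}"
      then have "j \<noteq> 2 * p" for p by auto
      then have "fps_nth ((1 + ?X ^ 2) ^ j) j = 0"
        unfolding sq by (intro sum.neutral) simp
      then show "real (?n choose j) * 2 ^ (?n - j) * fps_nth ((1 + ?X ^ 2) ^ j) j = 0" by simp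
    qed
  qed auto
  also have "\<dots> = (\<Sum>p\<le>m. 2 ^ (?n - 2 * p) * real (?n choose (2 * p)) * real ((2 * p) choose p))"
    by (subst sum.reindex) (auto simp: inj_on_def sq intro!: sum.cong)
  finally show ?thesis ..
qed

lemma overlap_count_0: "overlap_count 0 k = (real ((2 * k) choose k))\<^sup>2"
proof -
  have "gap_lists (Suc 0) k k = {[(k, k)]}"
    by (auto simp: gap_lists_def length_Suc_conv)
  then show ?thesis by (simp add: overlap_count_def mult_2)
qed

text \<open>
  For \<open>t = 1\<close> the exponent \<open>(t + 1) / 2\<close> is 1, a geometric series, so the generalized binomial
  coefficients all equal 1.
\<close>

lemma overlap_count_1: "overlap_count 1 m = real ((4 * m + 2) choose (2 * m + 1)) / 2"
proof -
  have one: "(real s + (real 1 + 1) / 2 - 1) gchoose s = 1" for s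
    by (simp add: binomial_gbinomial[symmetric])
  have "overlap_count 1 m * 2 =
      (\<Sum>s\<le>m. 2 ^ (2 * s + 1) * real ((2 * m + 1) choose (2 * m - 2 * s)) * real ((2 * m - 2 * s) choose (m - s)))"
    unfolding overlap_count_eq one sum_distrib_right
    by (intro sum.cong refl) (simp add: power_mult add.commute)
  also have "\<dots> = (\<Sum>p\<le>m. 2 ^ (2 * m + 1 - 2 * p) * real ((2 * m + 1) choose (2 * p)) * real ((2 * p) choose p))"
    by (rule sum.reindex_bij_witness[of _ "\<lambda>p. m - p" "\<lambda>p. m - p"])
       (auto simp: algebra_simps)
  also have "\<dots> = real ((4 * m + 2) choose (2 * m + 1))"
    by (rule sum_even_choose_eq_central_binomial)
  finally show ?thesis by simp
qed

section \<open>Expansion of falling factorials\<close>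

definition falling :: "nat \<Rightarrow> nat \<Rightarrow> real" where
  "falling j n = (\<Prod>i<j. real n - real i)"

lemma falling_simps [simp]: "falling 0 n = 1" "falling (Suc j) n = falling j n * (real n - real j)"
  by (simp_all add: falling_def)

lemma choose_eq_falling: "real (n choose j) = falling j n / fact j"
  by (simp add: falling_def binomial_gbinomial gbinomial_prod_rev atLeast0LessThan)

lemma falling_asymp: "(\<lambda>n. falling j n / real n ^ j) \<longlonglongrightarrow> 1"
proof (induction j)
  case (Suc j)
  have "(\<lambda>n. (falling j n / real n ^ j) * ((real n - real j) / real n)) \<longlonglongrightarrow> 1 * 1"
    by (intro tendsto_mult Suc.IH) real_asymp
  then show ?case by (simp add: mult.commute)
qed simp

text \<open>
  The second coefficient of the falling factorial. The extra factor \<open>real n\<close> keeps the exponent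
  \<open>j\<close>, which makes the induction uniform down to \<open>j = 0\<close>.
\<close>

lemma falling_second_order:
  "(\<lambda>n. (falling j n - real n ^ j) * real n / real n ^ j) \<longlonglongrightarrow> - (real j * (real j - 1) / 2)"
proof (induction j)
  case (Suc j)
  have "(\<lambda>n. (falling j n - real n ^ j) * real n / real n ^ j - real j * (falling j n / real n ^ j))
      \<longlonglongrightarrow> - (real j * (real j - 1) / 2) - real j * 1"
    by (intro tendsto_intros Suc.IH falling_asymp)
  moreover have "eventually (\<lambda>n. (falling j n - real n ^ j) * real n / real n ^ j - real j * (falling j n / real n ^ j)
      = (falling (Suc j) n - real n ^ Suc j) * real n / real n ^ Suc j) sequentially"
    using eventually_gt_at_top[of 0] by eventually_elim (simp add: field_simps)
  ultimately have "(\<lambda>n. (falling (Suc j) n - real n ^ Suc j) * real n / real n ^ Suc j)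
      \<longlonglongrightarrow> - (real j * (real j - 1) / 2) - real j * 1"
    by (rule Lim_transform_eventually)
  moreover have "- (real j * (real j - 1) / 2) - real j * 1 = - (real (Suc j) * (real (Suc j) - 1) / 2)"
    by (simp add: field_simps)
  ultimately show ?case by simp
qed simp

lemma falling_lower_order:
  assumes "m + j < q"
  shows "(\<lambda>n. falling m n * real n ^ j / real n ^ q) \<longlonglongrightarrow> 0"
proof -
  have "filterlim (\<lambda>n. real n ^ (q - (m + j))) at_top sequentially"
    using assms by (intro filterlim_pow_at_top filterlim_real_sequentially) simp
  then have "(\<lambda>n. falling m n / real n ^ m * inverse (real n ^ (q - (m + j)))) \<longlonglongrightarrow> 1 * 0"
    by (intro tendsto_mult falling_asymp tendsto_inverse_0_at_top)
  moreover have "eventually (\<lambda>n. falling m n / real n ^ m * inverse (real n ^ (q - (m + j)))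
      = falling m n * real n ^ j / real n ^ q) sequentially"
    using eventually_gt_at_top[of 0]
  proof eventually_elim
    case (elim n)
    have "real n ^ q = real n ^ m * real n ^ j * real n ^ (q - (m + j))"
      using assms by (simp flip: power_add)
    with elim show ?case by (simp add: field_simps)
  qed
  ultimately show ?thesis by (simp add: Lim_transform_eventually)
qed

text \<open>
  The falling factorial of length \<open>2k\<close> has second coefficient \<open>- k (2k - 1)\<close>; the square of the one
  of length \<open>k\<close> has twice \<open>- k (k - 1) / 2\<close>.
\<close>

lemma falling_square_second_order:
  "(\<lambda>n. (falling (2 * k) n - (falling k n)\<^sup>2) * real n / real n ^ (2 * k)) \<longlonglongrightarrow> - ((real k)\<^sup>2)"
proof -
  have "(\<lambda>n. (falling (2 * k) n - real n ^ (2 * k)) * real n / real n ^ (2 * k)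
        - (falling k n - real n ^ k) * real n / real n ^ k * (falling k n / real n ^ k + 1))
      \<longlonglongrightarrow> - (real (2 * k) * (real (2 * k) - 1) / 2) - - (real k * (real k - 1) / 2) * (1 + 1)"
    by (intro tendsto_intros falling_second_order falling_asymp)
  moreover have "eventually (\<lambda>n. (falling (2 * k) n - real n ^ (2 * k)) * real n / real n ^ (2 * k)
        - (falling k n - real n ^ k) * real n / real n ^ k * (falling k n / real n ^ k + 1)
      = (falling (2 * k) n - (falling k n)\<^sup>2) * real n / real n ^ (2 * k)) sequentially"
    using eventually_gt_at_top[of 0]
  proof eventually_elim
    case (elim n)
    have "real n ^ (2 * k) = real n ^ k * real n ^ k" by (simp add: mult_2 power_add)
    with elim show ?case by (simp add: field_simps power2_eq_square)
  qed
  ultimately have "(\<lambda>n. (falling (2 * k) n - (falling k n)\<^sup>2) * real n / real n ^ (2 * k))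
      \<longlonglongrightarrow> - (real (2 * k) * (real (2 * k) - 1) / 2) - - (real k * (real k - 1) / 2) * (1 + 1)"
    by (rule Lim_transform_eventually)
  moreover have "- (real (2 * k) * (real (2 * k) - 1) / 2) - - (real k * (real k - 1) / 2) * (1 + 1) = - ((real k)\<^sup>2)"
    by (simp add: field_simps power2_eq_square)
  ultimately show ?thesis by simp
qed

section \<open>Asymptotics of the second moment and of the variance\<close>

text \<open>
  The square sum of row \<open>2k - 1\<close> of the Pascal triangle contains the two equal middle squares and the
  square at the border, which is a third one because \<open>k \<ge> 2\<close>.
\<close>

lemma central_binomial_gt:
  assumes "k \<ge> 2"
  shows "2 * ((2 * k - 1) choose k)\<^sup>2 < (4 * k - 2) choose (2 * k - 1)"
proof -
  let ?n = "2 * k - 1"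
  have sym: "?n choose (k - 1) = ?n choose k"
    using assms binomial_symmetric[of k ?n] by (simp add: diff_diff_left)
  have "(?n choose 0)\<^sup>2 + ((?n choose (k - 1))\<^sup>2 + (?n choose k)\<^sup>2) = (\<Sum>i\<in>{0, k - 1, k}. (?n choose i)\<^sup>2)"
    using assms by (simp del: binomial_n_0)
  also have "\<dots> \<le> (\<Sum>i\<le>?n. (?n choose i)\<^sup>2)"
    using assms by (intro sum_mono2) auto
  also have "\<dots> = (2 * ?n) choose ?n"
    by (rule choose_square_sum)
  also have "2 * ?n = 4 * k - 2" by simp
  finally show ?thesis unfolding sym by simp
qed

text \<open>
  The coefficients of the second moment in the basis of falling factorials.
\<close>

definition overlap_coeff :: "nat \<Rightarrow> nat \<Rightarrow> real" where
  "overlap_coeff k t = overlap_count t (k - t) / (fact (2 * k - t))\<^sup>2"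

lemma expectation_Z_square_falling:
  "measure_pmf.expectation (random_perm n) (\<lambda>\<pi>. (Z n k \<pi>)\<^sup>2) = (\<Sum>t\<le>k. overlap_coeff k t * falling (2 * k - t) n)"
  unfolding expectation_Z_square
  by (intro sum.cong) (auto simp: overlap_coeff_def choose_eq_falling power2_eq_square)

lemma overlap_coeff_0: "overlap_coeff k 0 = 1 / (fact k) ^ 4"
proof -
  have "real ((2 * k) choose k) = fact (2 * k) / (fact k * fact k)"
    by (simp add: binomial_fact)
  then show ?thesis
    by (simp add: overlap_coeff_def overlap_count_0 power2_eq_square power4_eq_xxxx)
qed

lemma overlap_coeff_1:
  assumes "k \<ge> 1"
  shows "overlap_coeff k 1 = real ((4 * k - 2) choose (2 * k - 1)) / (2 * (fact (2 * k - 1))\<^sup>2)"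
proof -
  have "4 * (k - 1) + 2 = 4 * k - 2" "2 * (k - 1) + 1 = 2 * k - 1"
    using assms by simp_all
  then show ?thesis by (simp only: overlap_coeff_def overlap_count_1 divide_divide_eq_left)
qed

lemma expectation_Z_square_asymp:
  "(\<lambda>n. measure_pmf.expectation (random_perm n) (\<lambda>\<pi>. (Z n k \<pi>)\<^sup>2))
      \<sim>[sequentially] (\<lambda>n. real n ^ (2 * k) / (fact k) ^ 4)"
proof -
  have "(\<lambda>n. overlap_coeff k t * (falling (2 * k - t) n / real n ^ (2 * k)))
      \<longlonglongrightarrow> overlap_coeff k t * (if t = 0 then 1 else 0)" if "t \<le> k" for t
    using falling_asymp[of "2 * k"] falling_lower_order[of "2 * k - t" 0 "2 * k"] that
    by (intro tendsto_mult_left) auto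
  then have "(\<lambda>n. \<Sum>t\<le>k. overlap_coeff k t * (falling (2 * k - t) n / real n ^ (2 * k)))
      \<longlonglongrightarrow> (\<Sum>t\<le>k. overlap_coeff k t * (if t = 0 then 1 else 0))"
    by (intro tendsto_sum) auto
  also have "(\<Sum>t\<le>k. overlap_coeff k t * (if t = 0 then 1 else 0)) = 1 / (fact k) ^ 4"
    by (simp add: overlap_coeff_0 if_distrib cong: if_cong)
  finally have "(\<lambda>n. measure_pmf.expectation (random_perm n) (\<lambda>\<pi>. (Z n k \<pi>)\<^sup>2) / real n ^ (2 * k))
      \<longlonglongrightarrow> 1 / (fact k) ^ 4"
    by (simp add: expectation_Z_square_falling sum_divide_distrib)
  from asymp_equivI'_const[OF this] show ?thesis by simp
qed

lemma variance_Z: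
  "measure_pmf.variance (random_perm n) (Z n k) =
     (\<Sum>t\<le>k. overlap_coeff k t * falling (2 * k - t) n) - (falling k n)\<^sup>2 / (fact k) ^ 4"
proof -
  have "finite (set_pmf (random_perm n))"
    unfolding random_perm_def
    by (subst set_pmf_of_set) (auto simp: finite_permutations intro: exI[of _ id] permutes_id)
  then have "measure_pmf.variance (random_perm n) (Z n k) =
      measure_pmf.expectation (random_perm n) (\<lambda>\<pi>. (Z n k \<pi>)\<^sup>2) - (measure_pmf.expectation (random_perm n) (Z n k))\<^sup>2"
    by (intro measure_pmf.variance_eq integrable_measure_pmf_finite)
  also have "\<dots> = (\<Sum>t\<le>k. overlap_coeff k t * falling (2 * k - t) n) - (falling k n)\<^sup>2 / (fact k) ^ 4"
    unfolding expectation_Z_square_falling expectation_Z choose_eq_falling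
    by (simp add: power_mult_distrib power_divide)
  finally show ?thesis .
qed

text \<open>
  The term \<open>t = 0\<close> is compared with the squared mean, where the leading powers cancel; the term
  \<open>t = 1\<close> is of the same order as what remains, and later terms are smaller.
\<close>

lemma variance_Z_limit:
  assumes "k \<ge> 1"
  shows "(\<lambda>n. measure_pmf.variance (random_perm n) (Z n k) / real n ^ (2 * k - 1))
    \<longlonglongrightarrow> overlap_coeff k 1 - (real k)\<^sup>2 / (fact k) ^ 4"
proof -
  have split: "(\<Sum>t\<le>k. f t) = f 0 + (\<Sum>t\<in>{1..k}. f t)" for f :: "nat \<Rightarrow> real"
    by (simp add: atMost_atLeast0 sum.atLeast_Suc_atMost)
  have lead: "(\<lambda>n. (falling (2 * k) n - (falling k n)\<^sup>2) * real n / real n ^ (2 * k) / (fact k) ^ 4)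
      \<longlonglongrightarrow> - ((real k)\<^sup>2) / (fact k) ^ 4"
    by (intro tendsto_divide falling_square_second_order tendsto_const) simp
  have "(\<lambda>n. falling (2 * k - 1) n * real n / real n ^ (2 * k)) \<longlonglongrightarrow> 1"
  proof (rule Lim_transform_eventually[OF falling_asymp])
    \<comment> \<open>needed because of the truncated subtraction in the exponent\<close>
    have "2 * k = Suc (2 * k - 1)" using assms by simp
    then have pow: "real n ^ (2 * k) = real n ^ (2 * k - 1) * real n" for n
      by (metis power_Suc2)
    show "eventually (\<lambda>n. falling (2 * k - 1) n / real n ^ (2 * k - 1)
        = falling (2 * k - 1) n * real n / real n ^ (2 * k)) sequentially"
      using eventually_gt_at_top[of 0]
    proof eventually_elim
      case (elim n)
      then show ?case unfolding pow by simp
    qed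
  qed
  then have "(\<lambda>n. overlap_coeff k t * (falling (2 * k - t) n * real n / real n ^ (2 * k)))
      \<longlonglongrightarrow> overlap_coeff k t * (if t = 1 then 1 else 0)" if "t \<in> {1..k}" for t
    using falling_lower_order[of "2 * k - t" 1 "2 * k"] that
    by (intro tendsto_mult_left) auto
  then have "(\<lambda>n. \<Sum>t\<in>{1..k}. overlap_coeff k t * (falling (2 * k - t) n * real n / real n ^ (2 * k)))
      \<longlonglongrightarrow> (\<Sum>t\<in>{1..k}. overlap_coeff k t * (if t = 1 then 1 else 0))"
    by (intro tendsto_sum)
  also have "(\<Sum>t\<in>{1..k}. overlap_coeff k t * (if t = 1 then 1 else 0)) = overlap_coeff k 1"
    using assms by (simp add: if_distrib cong: if_cong)
  finally have "(\<lambda>n. (falling (2 * k) n - (falling k n)\<^sup>2) * real n / real n ^ (2 * k) / (fact k) ^ 4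
      + (\<Sum>t\<in>{1..k}. overlap_coeff k t * (falling (2 * k - t) n * real n / real n ^ (2 * k))))
      \<longlonglongrightarrow> - ((real k)\<^sup>2) / (fact k) ^ 4 + overlap_coeff k 1"
    by (intro tendsto_add lead)
  moreover have "eventually (\<lambda>n. (falling (2 * k) n - (falling k n)\<^sup>2) * real n / real n ^ (2 * k) / (fact k) ^ 4
      + (\<Sum>t\<in>{1..k}. overlap_coeff k t * (falling (2 * k - t) n * real n / real n ^ (2 * k)))
      = measure_pmf.variance (random_perm n) (Z n k) / real n ^ (2 * k - 1)) sequentially"
    using eventually_gt_at_top[of 0]
  proof eventually_elim
    case (elim n)
    \<comment> \<open>the form with exponent \<open>2 k\<close> matches the limits for falling factorials\<close>
    have pow: "1 / real n ^ (2 * k - 1) = real n / real n ^ (2 * k)"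
    proof -
      have "2 * k = Suc (2 * k - 1)" using assms by simp
      then have "real n ^ (2 * k) = real n ^ (2 * k - 1) * real n" by (metis power_Suc2)
      with elim show ?thesis by simp
    qed
    have "measure_pmf.variance (random_perm n) (Z n k) / real n ^ (2 * k - 1)
        = measure_pmf.variance (random_perm n) (Z n k) * (real n / real n ^ (2 * k))"
      by (simp flip: pow)
    also have "\<dots> = (falling (2 * k) n - (falling k n)\<^sup>2) / (fact k) ^ 4 * (real n / real n ^ (2 * k))
        + (\<Sum>t\<in>{1..k}. overlap_coeff k t * falling (2 * k - t) n * (real n / real n ^ (2 * k)))"
      unfolding variance_Z split overlap_coeff_0
      by (simp add: algebra_simps diff_divide_distrib sum_distrib_left sum_distrib_right)
    finally show ?case by (simp add: mult.assoc)
  qed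
  ultimately have "(\<lambda>n. measure_pmf.variance (random_perm n) (Z n k) / real n ^ (2 * k - 1))
      \<longlonglongrightarrow> - ((real k)\<^sup>2) / (fact k) ^ 4 + overlap_coeff k 1"
    by (rule Lim_transform_eventually)
  then show ?thesis by simp
qed

text \<open>
  The subtracted term is a square: \<open>k / (k!)\<^sup>2\<close> is the quotient of \<open>(2k - 1) choose k\<close> by \<open>(2k - 1)!\<close>.
\<close>

lemma variance_constant:
  assumes "k \<ge> 1"
  shows "overlap_coeff k 1 - (real k)\<^sup>2 / (fact k) ^ 4 =
    1 / (2 * (fact (2 * k - 1))\<^sup>2)
          * (real ((4 * k - 2) choose (2 * k - 1)) - 2 * (real ((2 * k - 1) choose k))\<^sup>2)"
proof -
  have "real ((2 * k - 1) choose k) / fact (2 * k - 1) = 1 / (fact k * fact (k - 1))"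
  proof -
    have "2 * k - 1 - k = k - 1" using assms by simp
    then show ?thesis using assms by (simp add: binomial_fact)
  qed
  also have "\<dots> = real k / (fact k)\<^sup>2"
    using assms fact_reduce[of k, where 'a = real] by (simp add: power2_eq_square)
  finally have "(real ((2 * k - 1) choose k))\<^sup>2 / (fact (2 * k - 1))\<^sup>2 = (real k)\<^sup>2 / (fact k) ^ 4"
    by (simp add: power_divide[symmetric] power_mult[symmetric]) (simp add: power_divide flip: power_mult)
  then show ?thesis
    unfolding overlap_coeff_1[OF assms] by (simp add: right_diff_distrib)
qed

text \<open>
  For \<open>k = 1\<close> the limit in \<open>variance_Z_limit\<close> is 0, which says nothing about asymptotic equivalence;
  the variance has to vanish exactly.
\<close>

lemma variance_Z_1: "measure_pmf.variance (random_perm n) (Z n 1) = 0"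
proof -
  have coeffs: "overlap_coeff 1 0 = 1" "overlap_coeff 1 1 = 1"
    using overlap_coeff_0[of 1] overlap_coeff_1[of 1] by (simp_all add: numeral_2_eq_2)
  have "measure_pmf.variance (random_perm n) (Z n 1) =
      overlap_coeff 1 0 * falling 2 n + overlap_coeff 1 1 * falling 1 n - (falling 1 n)\<^sup>2"
    unfolding variance_Z by (simp add: numeral_2_eq_2)
  also have "\<dots> = 0"
    unfolding coeffs by (simp add: numeral_2_eq_2 algebra_simps)
  finally show ?thesis .
qed

theorem theorem5p1:
  fixes k :: nat
  assumes "k \<ge> 1"
  shows "(\<forall>n. measure_pmf.expectation (random_perm n) (Z n k) = real (n choose k) * (1 / fact k)) \<and>
    (\<forall>n. measure_pmf.expectation (random_perm n) (\<lambda>\<pi>. (Z n k \<pi>)\<^sup>2) =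
      (\<Sum>(t, s)\<in>{(t, s). t + s \<le> k}.
         4 ^ (k - t) / fact (2 * k - t) * real (n choose (2 * k - t))
         * ((real k - real t - real s - 1 / 2) gchoose (k - t - s))
         * ((real s + (real t + 1) / 2 - 1) gchoose s)
         * real ((2 * k - t) choose (2 * k - 2 * t - 2 * s)))) \<and>
    (\<lambda>n. measure_pmf.expectation (random_perm n) (\<lambda>\<pi>. (Z n k \<pi>)\<^sup>2))
      \<sim>[sequentially] (\<lambda>n. real n ^ (2 * k) / (fact k) ^ 4) \<and>
    (\<lambda>n. measure_pmf.variance (random_perm n) (Z n k))
      \<sim>[sequentially]
        (\<lambda>n. 1 / (2 * (fact (2 * k - 1))\<^sup>2)
          * (real ((4 * k - 2) choose (2 * k - 1)) - 2 * (real ((2 * k - 1) choose k))\<^sup>2)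
          * real n ^ (2 * k - 1))"
proof (intro conjI allI)
  show "measure_pmf.expectation (random_perm n) (Z n k) = real (n choose k) * (1 / fact k)" for n
    by (rule expectation_Z)
  show "measure_pmf.expectation (random_perm n) (\<lambda>\<pi>. (Z n k \<pi>)\<^sup>2) =
      (\<Sum>(t, s)\<in>{(t, s). t + s \<le> k}.
         4 ^ (k - t) / fact (2 * k - t) * real (n choose (2 * k - t))
         * ((real k - real t - real s - 1 / 2) gchoose (k - t - s))
         * ((real s + (real t + 1) / 2 - 1) gchoose s)
         * real ((2 * k - t) choose (2 * k - 2 * t - 2 * s)))" for n
    unfolding expectation_Z_square by (rule second_moment_formula)
  show "(\<lambda>n. measure_pmf.expectation (random_perm n) (\<lambda>\<pi>. (Z n k \<pi>)\<^sup>2))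
      \<sim>[sequentially] (\<lambda>n. real n ^ (2 * k) / (fact k) ^ 4)"
    by (rule expectation_Z_square_asymp)
  show "(\<lambda>n. measure_pmf.variance (random_perm n) (Z n k))
      \<sim>[sequentially]
        (\<lambda>n. 1 / (2 * (fact (2 * k - 1))\<^sup>2)
          * (real ((4 * k - 2) choose (2 * k - 1)) - 2 * (real ((2 * k - 1) choose k))\<^sup>2)
          * real n ^ (2 * k - 1))"
  proof (cases "k = 1")
    case True
    have "real ((4 * k - 2) choose (2 * k - 1)) - 2 * (real ((2 * k - 1) choose k))\<^sup>2 = 0"
      using True by (simp add: numeral_2_eq_2)
    moreover have "measure_pmf.variance (random_perm n) (Z n k) = 0" for n
      unfolding True by (rule variance_Z_1)
    ultimately show ?thesis
      by (simp only: mult_zero_left mult_zero_right asymp_equiv_refl)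
  next
    case False
    then have "2 * ((2 * k - 1) choose k)\<^sup>2 < (4 * k - 2) choose (2 * k - 1)"
      using assms by (intro central_binomial_gt) simp
    then have "real (2 * ((2 * k - 1) choose k)\<^sup>2) < real ((4 * k - 2) choose (2 * k - 1))"
      by (simp only: of_nat_less_iff)
    then have "1 / (2 * (fact (2 * k - 1))\<^sup>2)
          * (real ((4 * k - 2) choose (2 * k - 1)) - 2 * (real ((2 * k - 1) choose k))\<^sup>2) \<noteq> 0"
      by simp
    then show ?thesis
      using variance_Z_limit[OF assms] unfolding variance_constant[OF assms]
      by (intro asymp_equivI'_const)
  qed
qed

end
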